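(* Let $U$ be an open set in the $n(d-1)$-dimensional space of E-points of $n$-qudit systems. Suppose that the eigenvalues are nondegenerate in $U$, i.e. for every $\lambda=(\lambda_i^{(a)})\in U$ and every $a$ the numbers $\lambda_1^{(a)},\ldots,\lambda_d^{(a)}$ are pairwise distinct. Suppose further that there is a real-valued function $f$ on $U$ with continuous and nowhere zero gradient such that an E-point $\lambda\in U$ has a corresponding $n$-qudit state if and only if $f(\lambda)\ge0$, and that the hypersurface $\{\lambda\in U: f(\lambda)=0\}$ is connected. Then this hypersurface is part of a hyperplane $V_N$ for some set $N$ of $n$-tuples; that is, there is a set $N\subset\{1,\ldots,d\}^n$ such that $V_N$ spans an affine hyperplane (it lies in an affine hyperplane and has dimension $n(d-1)-1$) and $\{\lambda\in U:f(\lambda)=0\}\subset V_N$.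
   Context: An $n$-qudit state is a unit vector $|\Psi\rangle=\sum_{1\le i_1,\ldots,i_n\le d}c_{i_1\cdots i_n}|i_1\rangle\otimes\cdots\otimes|i_n\rangle$, where $|1\rangle,\ldots,|d\rangle$ is an orthonormal basis of $\mathbb{C}^d$ ($d\ge 2$). Its $a$th reduced density matrix is $\rho^{(a)}_{ii'}=\sum c_{i_1\cdots i_{a-1}ii_{a+1}\cdots i_n}\overline{c_{i_1\cdots i_{a-1}i'i_{a+1}\cdots i_n}}$ (sum over all indices other than the $a$th). For a state, $\lambda_i^{(a)}$ denotes the $i$th smallest eigenvalue of $\rho^{(a)}$, so $\lambda_1^{(a)}\le\cdots\le\lambda_d^{(a)}$ and $\sum_i\lambda_i^{(a)}=1$. An E-point is a collection of real numbers $\lambda=(\lambda_i^{(a)})_{1\le i\le d,\,1\le a\le n}$ with $\sum_{i=1}^d\lambda_i^{(a)}=1$ for each $a$, regarded as a point of the $n(d-1)$-dimensional Euclidean space with coordinates $\lambda_i^{(a)}$, $1\le i\le d-1$, $1\le a\le n$ (so $\lambda_d^{(a)}=1-\sum_{i<d}\lambda_i^{(a)}$). An E-point $\lambda$ has a corresponding state if there is an $n$-qudit state such that for all $i,a$ the $i$th smallest eigenvalue of its $a$th reduced density matrix is $\lambda_i^{(a)}$. The lattice E-point $L_{i_1i_2\cdots i_n}$ is the E-point with $\lambda_{i_a}^{(a)}=1$ and $\lambda_i^{(a)}=0$ for $i\ne i_a$, for each $a$. For a set $N$ of $n$-tuples $[i_1\cdots i_n]\in\{1,\ldots,d\}^n$,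 $V_N$ is the convex set of all E-points of the form $\sum_{[i_1\cdots i_n]\in N}A_{i_1\cdots i_n}L_{i_1\cdots i_n}$ with $0\le A_{i_1\cdots i_n}\le1$ and $\sum_{[i_1\cdots i_n]\in N}A_{i_1\cdots i_n}=1$. *)

theory Defs
  imports "HOL-Analysis.Analysis" "HOL-Computational_Algebra.Computational_Algebra"
begin

text \<open>
  The parties \<open>1, \<dots>, n\<close> are the elements of a finite type \<open>'n\<close>. The levels \<open>1, \<dots>, d - 1\<close> are
  the elements of a finite linearly ordered type \<open>'m\<close>, so that \<open>d = CARD('m) + 1\<close>; as types are
  nonempty, \<open>n \<ge> 1\<close> and \<open>d \<ge> 2\<close> hold automatically. The full set of levels \<open>1, \<dots>, d\<close> is the
  type \<open>'m option\<close>, where \<open>None\<close> stands for the \<^emph>\<open>last\<close> level \<open>d\<close> (the order on \<open>option\<close> from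
  the library, which would put \<open>None\<close> first, is not used).
\<close>

definition level_number :: "'m::{finite,linorder} option \<Rightarrow> nat" where
  "level_number l = (case l of Some i \<Rightarrow> card {j. j \<le> i} | None \<Rightarrow> CARD('m) + 1)"

definition char_poly :: "'a::comm_ring_1 ^ 'k ^ 'k \<Rightarrow> 'a poly" where
  "char_poly A = det (\<chi> i j. (if i = j then [:0, 1:] else 0) - [:A $ i $ j:])"

text \<open>
  Eigenvalues are listed with algebraic multiplicity in ascending order. This is meant for
  Hermitian matrices, whose eigenvalues are real, so that taking real parts loses nothing.
\<close>

definition eigenvalue_list :: "complex ^ 'k ^ 'k \<Rightarrow> real list" where
  "eigenvalue_list A = sorted_list_of_multiset (image_mset Re (proots (char_poly A)))"

definition ith_smallest_eigenvalue :: "nat \<Rightarrow> complex ^ 'k ^ 'k \<Rightarrow> real" where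
  "ith_smallest_eigenvalue i A = eigenvalue_list A ! (i - 1)"

text \<open>
  A multi-index \<open>[i\<^sub>1 \<dots> i\<^sub>n]\<close> is a function from parties to levels, and a vector of
  \<open>(\<complex>\<^sup>d)\<^sup>\<otimes>\<^sup>n\<close> is given by its coefficients \<open>c\<close> with respect to the product basis.
\<close>

type_synonym ('m, 'n) multi_index = "'n \<Rightarrow> 'm option"

type_synonym ('m, 'n) qudits = "complex ^ ('n \<Rightarrow> 'm option)"

definition is_state :: "('m::finite, 'n::finite) qudits \<Rightarrow> bool" where
  "is_state c \<longleftrightarrow> norm c = 1"

text \<open>
  The sum over all indices other than the \<open>a\<close>th is written as a sum over the multi-indices whose
  \<open>a\<close>th entry is the row index.
\<close>

definition reduced_density ::
  "('m::finite, 'n::finite) qudits \<Rightarrow> 'n \<Rightarrow> complex ^ 'm option ^ 'm option" where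
  "reduced_density c a = (\<chi> i i'. \<Sum>t | t a = i. c $ t * cnj (c $ t(a := i')))"

text \<open>
  An E-point is given by its \<open>n (d - 1)\<close> independent coordinates; the entry for level \<open>d\<close>
  is determined by them.
\<close>

type_synonym ('m, 'n) epoint = "real ^ 'm ^ 'n"

definition entry :: "('m::finite, 'n::finite) epoint \<Rightarrow> 'n \<Rightarrow> 'm option \<Rightarrow> real" where
  "entry x a l = (case l of Some i \<Rightarrow> x $ a $ i | None \<Rightarrow> 1 - (\<Sum>i\<in>UNIV. x $ a $ i))"

lemma sum_entry: "(\<Sum>l\<in>UNIV. entry x a l) = 1"
  by (simp add: entry_def UNIV_option_conv sum.reindex)

definition has_state :: "('m::{finite,linorder}, 'n::finite) epoint \<Rightarrow> bool" where
  "has_state x \<longleftrightarrow> (\<exists>c :: ('m, 'n) qudits. is_state c \<and>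
     (\<forall>a l. ith_smallest_eigenvalue (level_number l) (reduced_density c a) = entry x a l))"

definition lattice_epoint :: "('m::finite, 'n::finite) multi_index \<Rightarrow> ('m, 'n) epoint" where
  "lattice_epoint t = (\<chi> a i. if t a = Some i then 1 else 0)"

lemma entry_lattice_epoint: "entry (lattice_epoint t) a l = (if l = t a then 1 else 0)"
  by (cases l; cases "t a") (auto simp: entry_def lattice_epoint_def)

definition V :: "('m::finite, 'n::finite) multi_index set \<Rightarrow> ('m, 'n) epoint set" where
  "V N = {\<Sum>t\<in>N. A t *\<^sub>R lattice_epoint t | A.
            (\<forall>t\<in>N. 0 \<le> A t \<and> A t \<le> 1) \<and> (\<Sum>t\<in>N. A t) = 1}"

end

theory Submission
  imports Defs
begin

text \<open>
  Let \<open>f x = 0\<close>, let \<open>w\<close> be the gradient at \<open>x\<close>, and rotate a state of \<open>x\<close> by local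
  unitaries until all its reduced density matrices are diagonal. Shifting weight \<open>s\<close> from the basis
  vector \<open>t1\<close> to \<open>t0\<close> of its support changes the spectra by \<open>s (L t0 - L t1) + o(s)\<close>, and the
  perturbed E-points satisfy \<open>f \<ge> 0\<close>. Hence \<open>w\<close> takes the same value on \<open>L t0\<close> and \<open>L t1\<close>, so
  \<open>x\<close> lies in the polytope \<open>V N\<close> spanned by the lattice E-points of a hyperplane normal to \<open>w\<close>.
  There are finitely many such polytopes, and those of codimension at least two cannot contain
  a neighbourhood in the hypersurface. Hence on a dense subset, and by continuity everywhere, the unit
  normal takes one of finitely many values. By connectedness it is a constant \<open>u\<close>, and so is
  \<open>u \<bullet> x\<close>, which also takes only finitely many values.
\<close>

unbundle no fps_syntax

section \<open>Characteristic polynomials and Hermitian matrices\<close>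

text \<open>A permutation other than the identity moves some index, and the factor at that index is
  a constant.\<close>

lemma degree_char_poly_term:
  fixes A :: "'a::idom ^ 'k ^ 'k"
  assumes "p permutes UNIV" "p \<noteq> id"
  shows "degree (\<Prod>i\<in>UNIV. (if i = p i then [:0, 1:] else 0) - [:A $ i $ p i:]) < CARD('k)"
proof -
  obtain j where j: "p j \<noteq> j" using assms(2) by fastforce
  have "degree (\<Prod>i\<in>UNIV. (if i = p i then [:0, 1:] else 0) - [:A $ i $ p i:])
      \<le> (\<Sum>i\<in>UNIV. degree ((if i = p i then [:0, 1:] else 0) - [:A $ i $ p i:]))"
    by (rule degree_prod_sum_le[unfolded comp_def]) simp
  also have "\<dots> < (\<Sum>i\<in>(UNIV::'k set). 1)"
    using j[symmetric] by (intro sum_strict_mono_ex1) auto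
  finally show ?thesis by simp
qed

text \<open>By the preceding bound only the identity permutation reaches degree
  \<open>CARD('k)\<close>, where it contributes the coefficient 1. Both claims follow from this
  monicity.\<close>

lemma degree_char_poly: "degree (char_poly (A :: 'a::idom ^ 'k ^ 'k)) = CARD('k)"
  and char_poly_nonzero: "char_poly A \<noteq> 0"
proof -
  define T where "T p = (\<Prod>i\<in>UNIV. (if i = p i then [:0, 1:] else 0) - [:A $ i $ p i:])" for p
  define P where "P = {p. p permutes (UNIV :: 'k set)}"
  have fin: "finite P" and idP: "id \<in> P"
    by (simp_all add: P_def finite_permutations permutes_id)
  have Tid: "T id = (\<Prod>i\<in>UNIV. [:- A $ i $ i, 1:])"
    by (simp add: T_def)
  have degid: "degree (T id) = CARD('k)" 
    unfolding Tid by (subst degree_prod_eq_sum_degree) auto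
  have "lead_coeff (T id) = 1"
    unfolding Tid by (subst lead_coeff_prod) simp
  then have lead: "coeff (T id) CARD('k) = 1" by (simp add: degid)
  have eq: "char_poly A = (\<Sum>p\<in>P. of_int (sign p) * T p)"
    by (simp add: char_poly_def det_def P_def T_def)
  have small: "degree (of_int (sign p) * T p) < CARD('k)" if "p \<in> P" "p \<noteq> id" for p
    using degree_char_poly_term[of p A] that
    by (auto simp: P_def T_def sign_def)
  have "coeff (char_poly A) CARD('k) = (\<Sum>p\<in>P. if p = id then 1 else 0)"
    unfolding eq coeff_sum
  proof (rule sum.cong)
    fix p assume "p \<in> P"
    then show "coeff (of_int (sign p) * T p) CARD('k) = (if p = id then 1 else 0)"
      using small[of p] lead by (auto simp: coeff_eq_0 sign_id)
  qed simp
  then have 1: "coeff (char_poly A) CARD('k) = 1"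
    using fin idP by simp
  moreover have "degree (char_poly A) \<le> CARD('k)"
    unfolding eq
  proof (rule degree_sum_le[OF fin])
    fix p assume "p \<in> P"
    then show "degree (of_int (sign p) * T p) \<le> CARD('k)"
      using small[of p] degid by (cases "p = id") (auto simp: sign_id)
  qed
  ultimately show "degree (char_poly A) = CARD('k)"
    by (intro antisym le_degree) auto
  show "char_poly A \<noteq> 0" using 1 by auto
qed

lemma poly_char_poly: "poly (char_poly A) z = det (mat z - A)"
  unfolding char_poly_def det_def poly_sum poly_mult poly_prod
  by (intro sum.cong arg_cong2[where f="(*)"] prod.cong)
     (auto simp: mat_def sign_def)

lemma char_poly_eigenvector:
  fixes A :: "'a::field ^ 'k ^ 'k"
  assumes "poly (char_poly A) z = 0"
  obtains v where "v \<noteq> 0" "A *v v = z *s v"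
proof -
  have "\<not> invertible (mat z - A)"
    using assms by (simp add: poly_char_poly invertible_det_nz)
  then obtain v where v: "v \<noteq> 0" "(mat z - A) *v v = 0"
    by (auto simp: invertible_left_inverse matrix_left_invertible_ker)
  have "mat z *v v = z *s v"
    by (simp add: vec_eq_iff matrix_vector_mult_def mat_def if_distrib cong: if_cong)
       (simp add: if_distribR sum.delta if_distrib cong: if_cong)
  then show ?thesis
    using v that by (auto simp: matrix_vector_mult_diff_rdistrib)
qed

section \<open>Hermitian matrices: real spectrum and unitary diagonalisation\<close>

definition adj :: "complex ^ 'k ^ 'l \<Rightarrow> complex ^ 'l ^ 'k" where
  "adj A = (\<chi> i j. cnj (A $ j $ i))"

definition hermitian :: "complex ^ 'k ^ 'k \<Rightarrow> bool" where
  "hermitian A \<longleftrightarrow> adj A = A"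

lemma hermitian_nth: "hermitian A \<Longrightarrow> cnj (A $ i $ j) = A $ j $ i"
  by (simp add: hermitian_def adj_def vec_eq_iff)

text \<open>The sesquilinear product, conjugate-linear in the first argument; \<open>inner\<close>
  on this type gives only its real part.\<close>

definition hdot :: "complex ^ 'k \<Rightarrow> complex ^ 'k \<Rightarrow> complex" where
  "hdot u v = (\<Sum>j\<in>UNIV. cnj (u $ j) * v $ j)"

lemma hdot_self: "hdot v v = complex_of_real ((norm v)\<^sup>2)"
  unfolding hdot_def norm_vec_def L2_set_def of_real_sum
  by (simp add: sum_nonneg complex_norm_square mult.commute del: of_real_power)

lemma hdot_scale: "hdot u (c *s v) = c * hdot u v" "hdot (c *s u) v = cnj c * hdot u v"
  by (simp_all add: hdot_def sum_distrib_left mult_ac)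

lemma hermitian_hdot:
  assumes "hermitian A"
  shows "hdot u (A *v v) = hdot (A *v u) v"
  unfolding hdot_def matrix_vector_mult_def
  apply (simp add: sum_distrib_left sum_distrib_right hermitian_nth[OF assms])
  apply (subst sum.swap)
  apply (simp add: mult_ac)
  done

text \<open>Moving \<open>A\<close> across \<open>hdot\<close> evaluates the same number in two
  ways. For \<open>u = v\<close> this makes eigenvalues real; for distinct real eigenvalues it makes
  eigenvectors orthogonal.\<close>

lemma hermitian_eigenvectors:
  assumes "hermitian A" "A *v u = y *s u" "A *v v = z *s v"
  shows "z * hdot u v = cnj y * hdot u v"
  using hermitian_hdot[OF assms(1), of u v] by (simp add: assms(2,3) hdot_scale)

lemma hermitian_root_real:
  assumes "hermitian A" "poly (char_poly A) z = 0"
  shows "z \<in> \<real>"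
proof -
  obtain v where "v \<noteq> 0" "A *v v = z *s v"
    using char_poly_eigenvector[OF assms(2)] by blast
  then have "z = cnj z"
    using hermitian_eigenvectors[OF assms(1), of v z v z] by (simp add: hdot_self)
  then show ?thesis by (simp add: complex_is_Real_iff complex_eq_iff)
qed

definition diag :: "('k::finite \<Rightarrow> real) \<Rightarrow> complex ^ 'k ^ 'k" where
  "diag r = (\<chi> i j. if i = j then of_real (r i) else 0)"

text \<open>As many distinct roots as the dimension give pairwise orthogonal unit eigenvectors;
  their conjugates are the rows of the unitary \<open>Q\<close>.\<close>

lemma hermitian_diagonalise:
  fixes A :: "complex ^ 'k ^ 'k" and r :: "'k \<Rightarrow> real"
  assumes "hermitian A" "inj r" and roots: "\<And>i. poly (char_poly A) (of_real (r i)) = 0"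
  obtains Q where "Q ** adj Q = mat 1" "Q ** A ** adj Q = diag r"
proof -
  have "\<exists>v. norm v = 1 \<and> A *v v = of_real (r i) *s v" for i
  proof -
    obtain v where v: "v \<noteq> 0" "A *v v = of_real (r i) *s v"
      using char_poly_eigenvector[OF roots] by blast
    have sc: "a *\<^sub>R w = complex_of_real a *s w" for a :: real and w :: "complex ^ 'k"
      by (simp add: vec_eq_iff scaleR_conv_of_real[where 'a = complex])
    let ?v = "(1 / norm v) *\<^sub>R v"
    have "norm ?v = 1" using v(1) by simp
    moreover have "A *v ?v = of_real (r i) *s ?v"
      unfolding sc by (simp add: vector_scalar_commute v(2) vector_smult_assoc mult.commute)
    ultimately show ?thesis by blast
  qed
  then obtain v where n: "\<And>i. norm (v i) = 1" and ev: "\<And>i. A *v v i = of_real (r i) *s v i"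
    by metis
  have ortho: "hdot (v i) (v j) = (if i = j then 1 else 0)" for i j
  proof (cases "i = j")
    case False
    then have "r j \<noteq> r i" using assms(2) by (auto dest: injD)
    then show ?thesis
      using False hermitian_eigenvectors[OF assms(1) ev[of i] ev[of j]] by simp
  qed (simp add: hdot_self n)
  define Q :: "complex ^ 'k ^ 'k" where "Q = (\<chi> i j. cnj (v i $ j))"
  have "(Q ** adj Q) $ i $ j = mat 1 $ i $ j" for i j
    using ortho[of i j] by (simp add: Q_def adj_def matrix_matrix_mult_def hdot_def mat_def)
  moreover have "(Q ** A ** adj Q) $ i $ j = diag r $ i $ j" for i j
  proof -
    have "(Q ** (A ** adj Q)) $ i $ j = hdot (v i) (A *v v j)"
      by (simp add: Q_def adj_def matrix_matrix_mult_def matrix_vector_mult_def hdot_def)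
    then show ?thesis
      by (simp add: matrix_mul_assoc ev hdot_scale ortho diag_def)
  qed
  ultimately show ?thesis
    by (intro that[of Q]) (simp_all add: vec_eq_iff)
qed

text \<open>The trace is invariant under the unitary conjugation that turns \<open>A\<close> into
  \<open>diag r\<close>.\<close>

lemma hermitian_trace:
  fixes A :: "complex ^ 'k ^ 'k" and r :: "'k \<Rightarrow> real"
  assumes "hermitian A" "inj r" and roots: "\<And>i. poly (char_poly A) (of_real (r i)) = 0"
  shows "trace A = of_real (\<Sum>i\<in>UNIV. r i)"
proof -
  obtain Q where Q: "Q ** adj Q = mat 1" "Q ** A ** adj Q = diag r"
    using hermitian_diagonalise[OF assms] by blast
  have "adj Q ** Q = mat 1"
    using Q(1) matrix_left_right_inverse by blast
  then have "trace (diag r) = trace A"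
    using Q(2) by (metis matrix_mul_assoc matrix_mul_rid trace_mul_sym)
  then show ?thesis by (simp add: trace_def diag_def)
qed

section \<open>Sorted eigenvalues\<close>

lemma level_number_less: "i < j \<Longrightarrow> level_number (Some i) < level_number (Some j)"
proof -
  assume "i < j"
  then have "{k. k \<le> i} \<subset> {k. k \<le> j}" by (auto simp: set_eq_iff dest: leD)
  then show ?thesis by (simp add: level_number_def psubset_card_mono)
qed

lemma level_number_Some: "level_number (Some i :: 'm::{finite,linorder} option) \<in> {1..CARD('m)}"
  by (auto simp: level_number_def Suc_le_eq card_gt_0_iff intro: card_mono)

lemma level_number_bounds: "level_number (l :: 'm::{finite,linorder} option) \<in> {1..CARD('m option)}"
  using level_number_Some by (cases l) (auto simp: level_number_def le_SucI)

lemma inj_level_number: "inj (level_number :: 'm::{finite,linorder} option \<Rightarrow> nat)"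
proof (rule injI)
  fix l k :: "'m option" assume eq: "level_number l = level_number k"
  have last: "level_number (Some i) \<noteq> level_number (None :: 'm option)" for i :: 'm
    using level_number_Some[of i] by (auto simp: level_number_def[of None])
  have "i = j" if "level_number (Some i) = level_number (Some j)" for i j :: 'm
    using that level_number_less[of i j] level_number_less[of j i]
    by (cases i j rule: linorder_cases) auto
  then show "l = k"
    using eq last by (cases l; cases k) (auto dest: sym)
qed

lemma range_level_number:
  "range (level_number :: 'm::{finite,linorder} option \<Rightarrow> nat) = {1..CARD('m option)}"
proof (rule card_subset_eq)
  show "range (level_number :: 'm option \<Rightarrow> nat) \<subseteq> {1..CARD('m option)}"
    using level_number_bounds[where 'm = 'm] by (intro image_subsetI) simp
qed (simp_all add: card_image inj_level_number)

lemma length_eigenvalue_list: "length (eigenvalue_list (A :: complex ^ 'k ^ 'k)) = CARD('k)"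
proof -
  have "mset (eigenvalue_list A) = image_mset Re (proots (char_poly A))"
    by (simp add: eigenvalue_list_def)
  then have "length (eigenvalue_list A) = size (image_mset Re (proots (char_poly A)))"
    by (metis size_mset)
  then show ?thesis by (simp add: size_proots_complex degree_char_poly)
qed

lemma char_poly_ith_smallest_eigenvalue:
  fixes A :: "complex ^ 'm::{finite,linorder} option ^ 'm option" and l :: "'m option"
  assumes "hermitian A"
  shows "poly (char_poly A) (of_real (ith_smallest_eigenvalue (level_number l) A)) = 0"
proof -
  have "level_number l \<in> {1..CARD('m option)}"
    by (rule level_number_bounds)
  then have "ith_smallest_eigenvalue (level_number l) A \<in> set (eigenvalue_list A)"
    unfolding ith_smallest_eigenvalue_def by (intro nth_mem) (auto simp: length_eigenvalue_list)
  then obtain z where "poly (char_poly A) z = 0" "ith_smallest_eigenvalue (level_number l) A = Re z"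
    by (auto simp: eigenvalue_list_def char_poly_nonzero)
  then show ?thesis using hermitian_root_real[OF assms] by simp
qed

lemma ith_smallest_eigenvalue_mono:
  fixes A :: "complex ^ 'm::{finite,linorder} option ^ 'm option" and l k :: "'m option"
  assumes "level_number l \<le> level_number k"
  shows "ith_smallest_eigenvalue (level_number l) A \<le> ith_smallest_eigenvalue (level_number k) A"
proof -
  have "level_number k \<in> {1..CARD('m option)}"
    by (rule level_number_bounds)
  then show ?thesis
    unfolding ith_smallest_eigenvalue_def using assms
    by (intro sorted_nth_mono) (auto simp: length_eigenvalue_list, auto simp: eigenvalue_list_def)
qed

text \<open>Distinct roots, as many as the degree, exhaust \<open>proots\<close> with multiplicity
  one; listed by level number they are sorted, hence form \<open>eigenvalue_list\<close>.\<close>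

lemma ith_smallest_eigenvalue_eqI:
  fixes A :: "complex ^ 'm::{finite,linorder} option ^ 'm option" and r :: "'m option \<Rightarrow> real"
  assumes roots: "\<And>l. poly (char_poly A) (of_real (r l)) = 0"
    and mono: "\<And>l k. level_number l < level_number k \<Longrightarrow> r l < r k"
  shows "ith_smallest_eigenvalue (level_number l) A = r l"
proof -
  define lev where "lev = inv_into (UNIV :: 'm option set) level_number"
  have lev: "lev (level_number l) = l" for l
    by (simp add: lev_def inj_level_number)
  have num: "level_number (lev i) = i" if "i \<in> {1..CARD('m option)}" for i
    unfolding lev_def by (rule f_inv_into_f) (simp only: range_level_number that)
  \<comment> \<open>List positions start at 0 and level numbers at 1, hence the
    \<open>Suc\<close>.\<close>
  define xs where "xs = map (\<lambda>i. r (lev (Suc i))) [0..<CARD('m option)]"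
  have "inj r"
  proof (rule injI)
    fix l k assume eq: "r l = r k"
    have "level_number l = level_number k"
    proof (cases "level_number l" "level_number k" rule: linorder_cases)
      case less then show ?thesis using mono[OF less] eq by simp
    next
      case greater then show ?thesis using mono[OF greater] eq by simp
    qed
    then show "l = k" by (metis lev)
  qed
  define X where "X = (\<lambda>l. complex_of_real (r l)) ` UNIV"
  have inj: "inj (\<lambda>l. complex_of_real (r l))" using \<open>inj r\<close> by (auto simp: inj_def)
  then have "card X = CARD('m option)" by (simp add: X_def card_image del: card_option)
  moreover have "X \<subseteq> set_mset (proots (char_poly A))"
    using roots by (auto simp: X_def char_poly_nonzero)
  then have "mset_set X \<subseteq># proots (char_poly A)"
    by (meson finite_set_mset mset_set_set_mset_msubset subset_imp_msubset_mset_set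
        subset_mset.order_trans)
  \<comment> \<open>An inclusion of multisets of equal size is an equality, so every root is
    simple.\<close>
  ultimately have "proots (char_poly A) = mset_set X"
    using mset_subset_size[of "mset_set X" "proots (char_poly A)"]
    by (metis degree_char_poly order_less_irrefl size_mset_set size_proots_complex subset_mset.less_le)
  then have "image_mset Re (proots (char_poly A)) = image_mset r (mset_set UNIV)"
    unfolding X_def by (simp add: image_mset_mset_set[OF inj, symmetric] image_mset.compositionality comp_def)
  also have "(UNIV :: 'm option set) = (\<lambda>i. lev (Suc i)) ` {0..<CARD('m option)}"
  proof (rule set_eqI)
    fix l :: "'m option"
    have "level_number l \<in> {1..CARD('m option)}"
      by (rule level_number_bounds)
    then show "l \<in> UNIV \<longleftrightarrow> l \<in> (\<lambda>i. lev (Suc i)) ` {0..<CARD('m option)}"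
      by (auto simp: lev image_iff simp del: card_option intro!: bexI[of _ "level_number l - 1"])
  qed
  also have "mset_set \<dots> = image_mset (\<lambda>i. lev (Suc i)) (mset_set {0..<CARD('m option)})"
  proof (rule image_mset_mset_set[symmetric])
    show "inj_on (\<lambda>i. lev (Suc i)) {0..<CARD('m option)}"
      using num by (intro inj_onI) (metis Suc_inject Suc_leI atLeastAtMost_iff atLeastLessThan_iff
          le_add1 plus_1_eq_Suc)
  qed
  finally have "image_mset Re (proots (char_poly A)) = mset xs"
    by (simp add: xs_def image_mset.compositionality comp_def del: card_option)
  moreover have "sorted xs"
    unfolding sorted_iff_nth_mono_less xs_def
    by (auto simp: num simp del: card_option intro!: less_imp_le mono)
  ultimately have "eigenvalue_list A = xs"
    by (simp add: eigenvalue_list_def sorted_sort_id)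
  moreover have "level_number l \<in> {1..CARD('m option)}"
    by (rule level_number_bounds)
  ultimately show ?thesis
    using lev[of l]
    by (cases "level_number l") (auto simp: ith_smallest_eigenvalue_def xs_def simp del: card_option)
qed

section \<open>Reduced density matrices\<close>

text \<open>Fixing the \<open>a\<close>th index at an arbitrary base level \<open>l\<close> treats
  row and column alike, unlike the defining sum.\<close>

lemma reduced_density_base:
  "reduced_density c a $ i $ j = (\<Sum>t | t a = l. c $ t(a := i) * cnj (c $ t(a := j)))"
  unfolding reduced_density_def
  by (simp, rule sum.reindex_bij_witness[where i = "\<lambda>t. t(a := i)" and j = "\<lambda>t. t(a := l)"]) auto

lemma hermitian_reduced_density: "hermitian (reduced_density c a)"
  by (simp add: hermitian_def adj_def vec_eq_iff reduced_density_base[where l = None] mult.commute)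

lemma sum_fibres:
  fixes g :: "('n::finite \<Rightarrow> 'l::finite) \<Rightarrow> 'b::comm_monoid_add"
  shows "(\<Sum>i\<in>UNIV. \<Sum>t | t a = i. g t) = (\<Sum>t\<in>UNIV. g t)"
  using sum.group[of UNIV UNIV "\<lambda>t. t a" g] by simp

lemma trace_reduced_density: "trace (reduced_density c a) = of_real ((norm c)\<^sup>2)"
proof -
  have "trace (reduced_density c a) = (\<Sum>i\<in>UNIV. \<Sum>t | t a = i. c $ t * cnj (c $ t))"
    unfolding trace_def reduced_density_def by (auto intro!: sum.cong)
  then show ?thesis
    using hdot_self[of c] by (simp add: sum_fibres hdot_def mult.commute)
qed

section \<open>Local unitaries and simultaneous diagonalisation of the reduced density
  matrices\<close>

definition apply_local ::
  "'n \<Rightarrow> complex ^ 'm option ^ 'm option \<Rightarrow> ('m::finite, 'n::finite) qudits \<Rightarrow> ('m, 'n) qudits" where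
  "apply_local a Q c = (\<chi> t. \<Sum>k\<in>UNIV. Q $ t a $ k * c $ t(a := k))"

lemma reduced_density_apply_local_same:
  "reduced_density (apply_local a Q c) a = Q ** reduced_density c a ** adj Q"
proof -
  have "reduced_density (apply_local a Q c) a $ i $ j
      = (\<Sum>t | t a = None. (\<Sum>k\<in>UNIV. \<Sum>l\<in>UNIV.
          Q $ i $ k * (c $ t(a := k) * cnj (c $ t(a := l))) * cnj (Q $ j $ l)))" for i j
    unfolding reduced_density_base[where l = None] apply_local_def
    by (simp add: sum_product mult_ac)
  also have "\<dots> i j = (\<Sum>k\<in>UNIV. \<Sum>l\<in>UNIV. Q $ i $ k * reduced_density c a $ k $ l * cnj (Q $ j $ l))"
    for i j
    unfolding reduced_density_base[where l = None] sum_distrib_left sum_distrib_right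
    by (subst sum.swap, intro sum.cong refl, subst sum.swap) simp
  also have "\<dots> i j = (Q ** reduced_density c a ** adj Q) $ i $ j" for i j
    by (subst sum.swap) (simp add: matrix_matrix_mult_def adj_def sum_distrib_right)
  finally show ?thesis by (simp add: vec_eq_iff)
qed

text \<open>Exchanging \<open>t a\<close> with \<open>k\<close> is an involution on the pairs
  \<open>(t, k)\<close>.\<close>

lemma sum_update_swap:
  fixes g :: "'l::finite \<Rightarrow> 'l \<Rightarrow> ('n::finite \<Rightarrow> 'l) \<Rightarrow> 'b::comm_monoid_add"
  assumes "\<And>t k. t \<in> X \<Longrightarrow> t(a := k) \<in> X"
  shows "(\<Sum>t\<in>X. \<Sum>k\<in>UNIV. g (t a) k (t(a := k))) = (\<Sum>t\<in>X. \<Sum>k\<in>UNIV. g k (t a) t)"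
  unfolding sum.cartesian_product
  by (rule sum.reindex_bij_witness[where i = "\<lambda>(t, k). (t(a := k), t a)" and j = "\<lambda>(t, k). (t(a := k), t a)"])
     (use assms in auto)

text \<open>Tracing out factor \<open>a\<close> contracts \<open>Q\<close> with its adjoint, and the
  two cancel by unitarity.\<close>

lemma reduced_density_apply_local_other:
  assumes Q: "adj Q ** Q = mat 1" and "a \<noteq> b"
  shows "reduced_density (apply_local a Q c) b = reduced_density c b"
proof -
  have "reduced_density (apply_local a Q c) b $ i $ j = reduced_density c b $ i $ j" for i j
  proof -
    \<comment> \<open>Here \<open>m\<close> is the level of \<open>a\<close> after applying
      \<open>Q\<close> and \<open>k\<close> the level before; the conjugated sum does not see the
      value of \<open>t\<close> at \<open>a\<close>.\<close>
    define g where "g m k t = Q $ m $ k * c $ t * cnj (\<Sum>l\<in>UNIV. Q $ m $ l * c $ t(b := j, a := l))"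
      for m k t
    have "reduced_density (apply_local a Q c) b $ i $ j
        = (\<Sum>t | t b = i. \<Sum>k\<in>UNIV. g (t a) k (t(a := k)))"
      using \<open>a \<noteq> b\<close>
      by (simp add: reduced_density_def apply_local_def g_def sum_distrib_right fun_upd_twist[OF \<open>a \<noteq> b\<close>])
    also have "\<dots> = (\<Sum>t | t b = i. \<Sum>k\<in>UNIV. g k (t a) t)"
      by (rule sum_update_swap) (use \<open>a \<noteq> b\<close> in auto)
    also have "\<dots> = (\<Sum>t | t b = i. c $ t * cnj (c $ t(b := j)))"
    proof (rule sum.cong[OF refl])
      fix t :: "'b \<Rightarrow> 'a option"
      have "(\<Sum>k\<in>UNIV. g k (t a) t)
          = (\<Sum>l\<in>UNIV. c $ t * cnj (c $ t(b := j, a := l)) * (\<Sum>k\<in>UNIV. cnj (Q $ k $ l) * Q $ k $ t a))"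
        unfolding g_def cnj_sum sum_distrib_left by (subst sum.swap) (simp add: mult_ac)
      also have "\<dots> = (\<Sum>l\<in>UNIV. c $ t * cnj (c $ t(b := j, a := l)) * (adj Q ** Q) $ l $ t a)"
        by (simp add: adj_def matrix_matrix_mult_def)
      also have "\<dots> = c $ t * cnj (c $ t(b := j))"
        using \<open>a \<noteq> b\<close> by (simp add: Q mat_def if_distrib cong: if_cong) (simp add: fun_upd_idem)
      finally show "(\<Sum>k\<in>UNIV. g k (t a) t) = c $ t * cnj (c $ t(b := j))" .
    qed
    finally show ?thesis by (simp add: reduced_density_def)
  qed
  then show ?thesis by (simp add: vec_eq_iff)
qed

text \<open>One party is diagonalised after another: a local unitary on one party leaves the reduced
  matrices of the others unchanged.\<close>

lemma has_state_diagonal: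
  fixes x :: "('m::{finite,linorder}, 'n::finite) epoint"
  assumes "has_state x" and inj: "\<And>a. inj (entry x a)"
  obtains c :: "('m, 'n) qudits" where "is_state c" "\<And>a. reduced_density c a = diag (entry x a)"
proof -
  obtain c :: "('m, 'n) qudits" where c: "is_state c"
    "\<And>a l. ith_smallest_eigenvalue (level_number l) (reduced_density c a) = entry x a l"
    using assms(1) unfolding has_state_def by blast
  \<comment> \<open>Induction over the set \<open>S\<close> of parties already treated.\<close>
  have "\<exists>c'. \<forall>a. reduced_density c' a = (if a \<in> S then diag (entry x a) else reduced_density c a)"
    if "finite S" for S
    using that
  proof induction
    case (insert b S)
    then obtain c' where
      c': "\<And>a. reduced_density c' a = (if a \<in> S then diag (entry x a) else reduced_density c a)"
      by blast
    have "poly (char_poly (reduced_density c b)) (of_real (entry x b l)) = 0" for l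
      using char_poly_ith_smallest_eigenvalue[OF hermitian_reduced_density] c(2) by metis
    then obtain Q where Q: "Q ** adj Q = mat 1" "Q ** reduced_density c b ** adj Q = diag (entry x b)"
      using hermitian_diagonalise[OF hermitian_reduced_density inj] by blast
    then have "adj Q ** Q = mat 1"
      using matrix_left_right_inverse by blast
    then have "reduced_density (apply_local b Q c') a
        = (if a \<in> insert b S then diag (entry x a) else reduced_density c a)" for a
      using insert.hyps c' Q(2)
      by (cases "a = b")
        (auto simp: reduced_density_apply_local_same reduced_density_apply_local_other)
    then show ?case by blast
  qed auto
  from this[of UNIV] obtain c' where c': "\<And>a. reduced_density c' a = diag (entry x a)"
    by auto
  \<comment> \<open>The norm is recovered from the trace at any one party, here
    \<open>undefined\<close>, since the entries at each party sum to 1.\<close>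
  have "complex_of_real ((norm c')\<^sup>2) = of_real (\<Sum>l\<in>UNIV. entry x undefined l)"
    unfolding trace_reduced_density[symmetric, of _ undefined] c' by (simp add: trace_def diag_def)
  then have "is_state c'"
    using power2_eq_iff_nonneg[of "norm c'" 1] by (simp add: sum_entry is_state_def flip: of_real_power)
  then show ?thesis using c' that by blast
qed

section \<open>First-order perturbation of simple eigenvalues\<close>

lemma cnj_det: "cnj (det A) = det (adj A)"
proof -
  have "cnj (det A) = det (transpose (adj A))"
    by (simp add: det_def adj_def transpose_def)
  then show ?thesis by simp
qed

text \<open>The determinant of a self-adjoint matrix equals its conjugate. Reality lets sign changes
  locate roots.\<close>

lemma char_poly_hermitian_real:
  assumes "hermitian A"
  shows "poly (char_poly A) (of_real x) \<in> \<real>"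
proof -
  have "adj (mat (of_real x) - A) = mat (of_real x) - adj A"
    by (simp add: adj_def mat_def vec_eq_iff)
  then have "cnj (det (mat (of_real x) - A)) = det (mat (of_real x) - A)"
    using assms by (simp add: cnj_det hermitian_def)
  then show ?thesis
    unfolding poly_char_poly complex_is_Real_iff by (simp add: complex_eq_iff)
qed

text \<open>Expand the determinant over permutations. The identity has the factor
  \<open>\<eta> * s\<close> at \<open>i\<close>; every other permutation involves at least two
  off-diagonal entries, each \<open>O(s)\<close>, and still vanishes in the limit after one division
  by \<open>s\<close>.\<close>

lemma tendsto_char_poly_near_diagonal:
  fixes M :: "real \<Rightarrow> complex ^ 'k ^ 'k"
  assumes diag: "\<And>i. ((\<lambda>s. M s $ i $ i) \<longlongrightarrow> of_real (D i)) (at_right 0)"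
    and off: "\<And>i j. i \<noteq> j \<Longrightarrow> ((\<lambda>s. M s $ i $ j / of_real s) \<longlongrightarrow> E i j) (at_right 0)"
  shows "((\<lambda>s. poly (char_poly (M s)) (M s $ i $ i + of_real (\<eta> * s)) / of_real s)
    \<longlongrightarrow> of_real (\<eta> * (\<Prod>k\<in>UNIV - {i}. D i - D k))) (at_right 0)"
proof -
  define F where "F s k l = (if k = l then M s $ i $ i + of_real (\<eta> * s) else 0) - M s $ k $ l"
    for s k l
  define L where "L k l = (if k = l then complex_of_real (D i - D k) else 0)" for k l
  define P where "P = {p. p permutes (UNIV :: 'k set)}"
  have fin: "finite P" and idP: "id \<in> P"
    by (simp_all add: P_def finite_permutations permutes_id)
  have s0: "((\<lambda>s. complex_of_real s) \<longlongrightarrow> 0) (at_right 0)"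
    using tendsto_of_real[OF tendsto_ident_at[of 0 "{0<..}"], where 'a = complex] by simp
  have nz: "\<forall>\<^sub>F s in at_right 0. complex_of_real s \<noteq> 0"
    by (auto simp: eventually_at_filter)
  have F: "((\<lambda>s. F s k l) \<longlongrightarrow> L k l) (at_right 0)" for k l
  proof (cases "k = l")
    case True
    have "((\<lambda>s. M s $ i $ i + of_real \<eta> * of_real s - M s $ k $ k)
        \<longlongrightarrow> of_real (D i) + of_real \<eta> * 0 - of_real (D k)) (at_right 0)"
      by (intro tendsto_intros diag s0)
    then show ?thesis by (simp add: F_def L_def True)
  next
    case False
    have "((\<lambda>s. of_real s * (M s $ k $ l / of_real s)) \<longlongrightarrow> 0 * E k l) (at_right 0)"
      by (intro tendsto_intros off False s0)
    moreover have "\<forall>\<^sub>F s in at_right 0. of_real s * (M s $ k $ l / of_real s) = M s $ k $ l"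
      using nz by eventually_elim simp
    ultimately have "((\<lambda>s. M s $ k $ l) \<longlongrightarrow> 0) (at_right 0)"
      using Lim_transform_eventually by fastforce
    then have "((\<lambda>s. - (M s $ k $ l)) \<longlongrightarrow> - 0) (at_right 0)"
      by (rule tendsto_minus)
    then show ?thesis using False by (simp add: F_def L_def)
  qed
  have "((\<lambda>s. of_int (sign p) * (\<Prod>k\<in>UNIV. F s k (p k)) / of_real s) \<longlongrightarrow>
      (if p = id then of_real (\<eta> * (\<Prod>k\<in>UNIV - {i}. D i - D k)) else 0)) (at_right 0)" if "p \<in> P" for p
  proof -
    have split: "of_int (sign p) * (\<Prod>k\<in>UNIV. F s k (p k)) / of_real s
        = of_int (sign p) * (F s j (p j) / of_real s) * (\<Prod>k\<in>UNIV - {j}. F s k (p k))" for s j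
      by (subst prod.remove[of UNIV j]) auto
    show ?thesis
    proof (cases "p = id")
      case True
      have "((\<lambda>s. F s i i / of_real s) \<longlongrightarrow> of_real \<eta>) (at_right 0)"
        by (rule tendsto_eventually, rule eventually_mono[OF nz]) (simp add: F_def)
      then have "((\<lambda>s. of_int (sign p) * (F s i (p i) / of_real s) * (\<Prod>k\<in>UNIV - {i}. F s k (p k)))
          \<longlongrightarrow> of_int (sign p) * of_real \<eta> * (\<Prod>k\<in>UNIV - {i}. L k (p k))) (at_right 0)"
        unfolding True by (intro tendsto_intros F) simp
      then show ?thesis
        unfolding split[of _ i] by (simp add: True sign_id L_def)
    next
      case False
      then obtain j where j: "p j \<noteq> j" by fastforce
      \<comment> \<open>\<open>p\<close> moves \<open>p j\<close> too: this second off-diagonal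
        factor tends to 0, while the one at \<open>j\<close> absorbs the division by
        \<open>s\<close>.\<close>
      have "p (p j) \<noteq> p j"
        using j that by (auto simp: P_def dest: permutes_inj injD)
      then have L0: "(\<Prod>k\<in>UNIV - {j}. L k (p k)) = 0"
        using j by (intro prod_zero bexI[of _ "p j"]) (auto simp: L_def)
      have "((\<lambda>s. - (M s $ j $ p j / of_real s)) \<longlongrightarrow> - E j (p j)) (at_right 0)"
        by (intro tendsto_intros off) (use j in auto)
      then have "((\<lambda>s. F s j (p j) / of_real s) \<longlongrightarrow> - E j (p j)) (at_right 0)"
        using j by (simp add: F_def)
      then have "((\<lambda>s. of_int (sign p) * (F s j (p j) / of_real s) * (\<Prod>k\<in>UNIV - {j}. F s k (p k)))
          \<longlongrightarrow> of_int (sign p) * (- E j (p j)) * (\<Prod>k\<in>UNIV - {j}. L k (p k))) (at_right 0)"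
        by (intro tendsto_intros F)
      then show ?thesis
        unfolding split[of _ j] L0 using False by simp
    qed
  qed
  then have "((\<lambda>s. \<Sum>p\<in>P. of_int (sign p) * (\<Prod>k\<in>UNIV. F s k (p k)) / of_real s) \<longlongrightarrow>
      (\<Sum>p\<in>P. if p = id then of_real (\<eta> * (\<Prod>k\<in>UNIV - {i}. D i - D k)) else 0)) (at_right 0)"
    by (intro tendsto_intros)
  moreover have "(\<Sum>p\<in>P. of_int (sign p) * (\<Prod>k\<in>UNIV. F s k (p k)) / of_real s)
      = poly (char_poly (M s)) (M s $ i $ i + of_real (\<eta> * s)) / of_real s" for s
    by (simp add: poly_char_poly det_def mat_def F_def P_def sum_divide_distrib del: of_real_mult)
  ultimately show ?thesis
    using fin idP by simp
qed

lemma continuous_sign_change_root: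
  fixes q :: "real \<Rightarrow> real"
  assumes "q (a - h) * q (a + h) < 0" "h \<ge> 0" "continuous_on UNIV q"
  obtains r where "\<bar>r - a\<bar> \<le> h" "q r = 0"
proof -
  have "continuous_on {a - h..a + h} q"
    using assms(3) continuous_on_subset by blast
  then obtain r where "a - h \<le> r" "r \<le> a + h" "q r = 0"
    using assms(1,2) IVT'[of q "a - h" 0 "a + h"] IVT2'[of q "a + h" 0 "a - h"]
    by (force simp: mult_less_0_iff)
  then show ?thesis using that[of r] by auto
qed

text \<open>At distance \<open>\<epsilon> * s\<close> on either side of the diagonal entry, the
  characteristic polynomial divided by \<open>s\<close> tends to \<open>\<epsilon> * C\<close> and
  to its negative, with \<open>C \<noteq> 0\<close> because \<open>D\<close> is injective. The
  intermediate value theorem gives a root between.\<close>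

lemma eventually_root_near_diagonal:
  fixes M :: "real \<Rightarrow> complex ^ 'k ^ 'k"
  assumes herm: "\<And>s. hermitian (M s)"
    and diag: "\<And>i. ((\<lambda>s. M s $ i $ i) \<longlongrightarrow> of_real (D i)) (at_right 0)"
    and off: "\<And>i j. i \<noteq> j \<Longrightarrow> ((\<lambda>s. M s $ i $ j / of_real s) \<longlongrightarrow> E i j) (at_right 0)"
    and "inj D" "\<epsilon> > 0"
  shows "\<forall>\<^sub>F s in at_right 0. \<exists>r. \<bar>r - Re (M s $ i $ i)\<bar> \<le> \<epsilon> * s \<and> poly (char_poly (M s)) (of_real r) = 0"
proof -
  define q where "q s x = Re (poly (char_poly (M s)) (of_real x))" for s x
  define C where "C = (\<Prod>k\<in>UNIV - {i}. D i - D k)"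
  have "C \<noteq> 0" using \<open>inj D\<close> by (auto simp: C_def dest: injD)
  have Mii: "M s $ i $ i = of_real (Re (M s $ i $ i))" for s
    using hermitian_nth[OF herm, of s i i] by (simp add: complex_eq_iff)
  have lim: "((\<lambda>s. q s (Re (M s $ i $ i) + \<eta> * s) / s) \<longlongrightarrow> \<eta> * C) (at_right 0)" for \<eta>
  proof -
    have "((\<lambda>s. poly (char_poly (M s)) (M s $ i $ i + of_real (\<eta> * s)) / of_real s)
        \<longlongrightarrow> of_real (\<eta> * C)) (at_right 0)"
      unfolding C_def by (rule tendsto_char_poly_near_diagonal[OF diag off])
    then have "((\<lambda>s. Re (poly (char_poly (M s)) (M s $ i $ i + of_real (\<eta> * s)) / of_real s))
        \<longlongrightarrow> \<eta> * C) (at_right 0)"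
      using tendsto_Re by fastforce
    moreover have "M s $ i $ i + of_real (\<eta> * s) = of_real (Re (M s $ i $ i) + \<eta> * s)" for s
      by (subst Mii) simp
    ultimately show ?thesis by (simp add: q_def del: of_real_add of_real_mult)
  qed
  \<comment> \<open>Taking the product of the two values makes the argument independent of the sign
    of \<open>C\<close>.\<close>
  have "((\<lambda>s. (q s (Re (M s $ i $ i) + (- \<epsilon>) * s) / s) * (q s (Re (M s $ i $ i) + \<epsilon> * s) / s))
      \<longlongrightarrow> (- \<epsilon> * C) * (\<epsilon> * C)) (at_right 0)"
    by (intro tendsto_mult lim)
  moreover have "(- \<epsilon> * C) * (\<epsilon> * C) < 0"
    using \<open>\<epsilon> > 0\<close> \<open>C \<noteq> 0\<close> by (auto simp: mult_less_0_iff zero_less_mult_iff)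
  ultimately have "\<forall>\<^sub>F s in at_right 0.
      (q s (Re (M s $ i $ i) + (- \<epsilon>) * s) / s) * (q s (Re (M s $ i $ i) + \<epsilon> * s) / s) < 0"
    by (rule order_tendstoD)
  moreover have "\<forall>\<^sub>F s in at_right 0. s > (0 :: real)"
    by (simp add: eventually_at_right_less)
  ultimately show ?thesis
  proof eventually_elim
    case (elim s)
    have "q s (Re (M s $ i $ i) - \<epsilon> * s) * q s (Re (M s $ i $ i) + \<epsilon> * s) < 0"
      using elim by (simp add: field_simps)
    moreover have "continuous_on UNIV (q s)"
      unfolding q_def by (intro continuous_intros)
    ultimately obtain r where r: "\<bar>r - Re (M s $ i $ i)\<bar> \<le> \<epsilon> * s" "q s r = 0"
      using continuous_sign_change_root[of "q s" "Re (M s $ i $ i)" "\<epsilon> * s"] elim \<open>\<epsilon> > 0\<close> by auto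
    have "poly (char_poly (M s)) (of_real r) = 0"
      using r(2) char_poly_hermitian_real[OF herm[of s], of r]
      by (simp add: q_def complex_eq_iff complex_is_Real_iff)
    with r(1) show ?case by blast
  qed
qed

text \<open>For small \<open>s\<close> the roots found near the diagonal entries are ordered like
  the limits \<open>D\<close>, so they are the sorted eigenvalues and their sum is the
  trace.\<close>

lemma eventually_eigenvalues_near_diagonal:
  fixes M :: "real \<Rightarrow> complex ^ 'm::{finite,linorder} option ^ 'm option"
  assumes herm: "\<And>s. hermitian (M s)"
    and diag: "\<And>i. ((\<lambda>s. M s $ i $ i) \<longlongrightarrow> of_real (D i)) (at_right 0)"
    and off: "\<And>i j. i \<noteq> j \<Longrightarrow> ((\<lambda>s. M s $ i $ j / of_real s) \<longlongrightarrow> E i j) (at_right 0)"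
    and mono: "\<And>i j. level_number i < level_number j \<Longrightarrow> D i < D j"
    and "\<epsilon> > 0"
  shows "\<forall>\<^sub>F s in at_right 0.
    (\<forall>i. \<bar>ith_smallest_eigenvalue (level_number i) (M s) - Re (M s $ i $ i)\<bar> \<le> \<epsilon> * s) \<and>
    (\<Sum>i\<in>(UNIV :: 'm option set). ith_smallest_eigenvalue (level_number i) (M s)) = Re (trace (M s))"
proof -
  have less: "level_number i < level_number j \<or> level_number j < level_number i"
    if "i \<noteq> j" for i j :: "'m option"
    using that inj_level_number by (metis injD nat_neq_iff)
  have "inj D"
    using mono less by (metis injI less_irrefl)
  have "\<forall>\<^sub>F s in at_right 0. \<forall>i. \<exists>r. \<bar>r - Re (M s $ i $ i)\<bar> \<le> \<epsilon> * s \<and> poly (char_poly (M s)) (of_real r) = 0"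
    by (intro eventually_all_finite allI eventually_root_near_diagonal[OF herm diag off \<open>inj D\<close> \<open>\<epsilon> > 0\<close>])
  \<comment> \<open>The intervals of radius \<open>\<epsilon> * s\<close> around the diagonal
    entries are eventually disjoint and in level order.\<close>
  moreover have "\<forall>\<^sub>F s in at_right 0. \<forall>i j. level_number i < level_number j \<longrightarrow>
      Re (M s $ j $ j) - \<epsilon> * s - (Re (M s $ i $ i) + \<epsilon> * s) > 0"
  proof (intro eventually_all_finite)
    fix i j :: "'m option"
    show "\<forall>\<^sub>F s in at_right 0. level_number i < level_number j \<longrightarrow>
      Re (M s $ j $ j) - \<epsilon> * s - (Re (M s $ i $ i) + \<epsilon> * s) > 0"
    proof (cases "level_number i < level_number j")
      case True
      have "((\<lambda>s. Re (M s $ j $ j) - \<epsilon> * s - (Re (M s $ i $ i) + \<epsilon> * s))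
          \<longlongrightarrow> Re (of_real (D j)) - \<epsilon> * 0 - (Re (of_real (D i)) + \<epsilon> * 0)) (at_right 0)"
        by (intro tendsto_intros diag)
      then have "\<forall>\<^sub>F s in at_right 0. Re (M s $ j $ j) - \<epsilon> * s - (Re (M s $ i $ i) + \<epsilon> * s) > 0"
        by (rule order_tendstoD) (use mono[OF True] in simp)
      then show ?thesis by (rule eventually_mono) simp
    qed simp
  qed
  ultimately show ?thesis
  proof eventually_elim
    case (elim s)
    then obtain r where r: "\<And>i. \<bar>r i - Re (M s $ i $ i)\<bar> \<le> \<epsilon> * s"
      "\<And>i. poly (char_poly (M s)) (of_real (r i)) = 0"
      by metis
    have r_mono: "r i < r j" if "level_number i < level_number j" for i j
      using elim(2)[rule_format, OF that] r(1)[of i] r(1)[of j] by linarith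
    then have "inj r"
      using less by (metis injI less_irrefl)
    have "ith_smallest_eigenvalue (level_number i) (M s) = r i" for i
      by (rule ith_smallest_eigenvalue_eqI[OF r(2) r_mono])
    moreover have "Re (trace (M s)) = (\<Sum>i\<in>UNIV. r i)"
      using hermitian_trace[OF herm \<open>inj r\<close> r(2)] by simp
    ultimately show ?case using r(1) by simp
  qed
qed

text \<open>As \<open>\<epsilon>\<close> is arbitrary, the error is \<open>o(s)\<close>. The trace
  identity later recovers the eigenvalue at level \<open>None\<close>, which an E-point does not
  store.\<close>

lemma eigenvalues_first_order:
  fixes M :: "real \<Rightarrow> complex ^ 'm::{finite,linorder} option ^ 'm option"
  assumes herm: "\<And>s. hermitian (M s)"
    and diag: "\<And>i. ((\<lambda>s. M s $ i $ i) \<longlongrightarrow> of_real (D i)) (at_right 0)"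
    and off: "\<And>i j. i \<noteq> j \<Longrightarrow> ((\<lambda>s. M s $ i $ j / of_real s) \<longlongrightarrow> E i j) (at_right 0)"
    and mono: "\<And>i j. level_number i < level_number j \<Longrightarrow> D i < D j"
  shows "((\<lambda>s. (ith_smallest_eigenvalue (level_number i) (M s) - Re (M s $ i $ i)) / s) \<longlongrightarrow> 0)
      (at_right 0)" (is ?lim)
    and "\<forall>\<^sub>F s in at_right 0.
      (\<Sum>i\<in>(UNIV :: 'm option set). ith_smallest_eigenvalue (level_number i) (M s)) = Re (trace (M s))" (is ?sum)
proof -
  have ev: "\<forall>\<^sub>F s in at_right 0.
    (\<forall>i. \<bar>ith_smallest_eigenvalue (level_number i) (M s) - Re (M s $ i $ i)\<bar> \<le> \<epsilon> * s) \<and>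
    (\<Sum>i\<in>(UNIV :: 'm option set). ith_smallest_eigenvalue (level_number i) (M s)) = Re (trace (M s))"
    if "\<epsilon> > 0" for \<epsilon>
    by (rule eventually_eigenvalues_near_diagonal[OF herm diag off mono that])
  show ?sum
    by (rule eventually_mono[OF ev[of 1]]) auto
  show ?lim
  proof (rule tendstoI)
    fix e :: real assume "e > 0"
    then have "e / 2 > 0" by simp
    have "\<forall>\<^sub>F s in at_right 0. s > (0 :: real)"
      by (simp add: eventually_at_right_less)
    with ev[OF \<open>e / 2 > 0\<close>]
    show "\<forall>\<^sub>F s in at_right 0.
      dist ((ith_smallest_eigenvalue (level_number i) (M s) - Re (M s $ i $ i)) / s) 0 < e"
    proof eventually_elim
      case (elim s)
      then have "\<bar>(ith_smallest_eigenvalue (level_number i) (M s) - Re (M s $ i $ i)) / s\<bar> \<le> e / 2"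
        by (simp add: pos_divide_le_eq)
      also have "\<dots> < e" using \<open>e > 0\<close> by simp
      finally show ?case by (simp add: dist_real_def)
    qed
  qed
qed

section \<open>First variation of a state\<close>

lemma entry_strict_mono:
  assumes "has_state x" "inj (entry x a)" "level_number l < level_number k"
  shows "entry x a l < entry x a k"
proof -
  obtain c :: "('a, 'b) qudits"
    where "\<And>a l. ith_smallest_eigenvalue (level_number l) (reduced_density c a) = entry x a l"
    using assms(1) unfolding has_state_def by blast
  then have "entry x a l \<le> entry x a k"
    using ith_smallest_eigenvalue_mono[of l k "reduced_density c a"] assms(3) by simp
  moreover have "l \<noteq> k" using assms(3) by auto
  ultimately show ?thesis
    using assms(2) by (auto simp: order_less_le dest: injD)
qed

text \<open>Moving weight between two basis vectors of the support keeps the norm, and it moves the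
  diagonals of all reduced density matrices exactly linearly; the off-diagonal entries are
  \<open>O(s)\<close>, so they change the simple eigenvalues only to second order.\<close>

lemma has_state_variation:
  fixes x :: "('m::{finite,linorder}, 'n::finite) epoint" and c :: "('m, 'n) qudits"
  assumes "is_state c" and c: "\<And>a. reduced_density c a = diag (entry x a)"
    and mono: "\<And>a l k. level_number l < level_number k \<Longrightarrow> entry x a l < entry x a k"
    and nz: "c $ t0 \<noteq> 0" "c $ t1 \<noteq> 0" and "t0 \<noteq> t1"
  obtains y where "\<forall>\<^sub>F s in at_right 0. has_state (y s)"
    "((\<lambda>s. (y s - x) /\<^sub>R s) \<longlongrightarrow> lattice_epoint t0 - lattice_epoint t1) (at_right 0)"
proof -
  define v :: "('m, 'n) multi_index \<Rightarrow> real" where "v t = of_bool (t = t0) - of_bool (t = t1)" for t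
  \<comment> \<open>The relative change that turns \<open>(cmod (c $ t))\<^sup>2\<close> into itself
    plus \<open>s * v t\<close>. Off the support of \<open>c\<close> also \<open>v t = 0\<close>, so
    the quotient is 0 there.\<close>
  define \<kappa> where "\<kappa> t = v t / (cmod (c $ t))\<^sup>2" for t
  have \<kappa>: "(cmod (c $ t))\<^sup>2 * \<kappa> t = v t" for t
    using nz by (auto simp: \<kappa>_def v_def)
  define cs :: "real \<Rightarrow> ('m, 'n) qudits" where "cs s = (\<chi> t. c $ t * of_real (sqrt (1 + \<kappa> t * s)))" for s
  define M where "M a s = reduced_density (cs s) a" for a s
  \<comment> \<open>For small \<open>s\<close> the radicands are positive, so the square roots
    square back exactly.\<close>
  have small: "\<forall>\<^sub>F s in at_right 0. \<forall>t. 1 + \<kappa> t * s > 0"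
  proof (intro eventually_all_finite)
    fix t
    have "((\<lambda>s. 1 + \<kappa> t * s) \<longlongrightarrow> 1 + \<kappa> t * 0) (at_right 0)"
      by (intro tendsto_intros)
    then show "\<forall>\<^sub>F s in at_right 0. 1 + \<kappa> t * s > 0"
      by (rule order_tendstoD) simp
  qed
  have v: "(\<Sum>t | t a = i. v t) = of_bool (t0 a = i) - of_bool (t1 a = i)" for a i
    by (simp add: v_def sum_subtractf of_bool_def if_distrib[of "\<lambda>b. b = True"])
  have v0: "(\<Sum>t\<in>UNIV. v t) = 0"
    by (simp add: v_def sum_subtractf of_bool_def)
  have mod_cs: "cs s $ t * cnj (cs s $ t) = c $ t * cnj (c $ t) + of_real (s * v t)"
    if "\<forall>t. 1 + \<kappa> t * s > 0" for s t
  proof -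
    have "cs s $ t * cnj (cs s $ t) = (c $ t * cnj (c $ t)) * of_real (sqrt (1 + \<kappa> t * s) * sqrt (1 + \<kappa> t * s))"
      by (simp add: cs_def del: real_sqrt_mult_self)
    also have "sqrt (1 + \<kappa> t * s) * sqrt (1 + \<kappa> t * s) = 1 + \<kappa> t * s"
      using that[rule_format, of t] by simp
    also have "(c $ t * cnj (c $ t)) * of_real (1 + \<kappa> t * s)
        = c $ t * cnj (c $ t) + of_real ((cmod (c $ t))\<^sup>2 * \<kappa> t * s)"
      by (simp add: complex_norm_square[symmetric] algebra_simps)
    finally show ?thesis by (simp only: \<kappa> mult.commute[of s])
  qed
  have diag_M: "M a s $ i $ i = of_real (entry x a i + s * (of_bool (t0 a = i) - of_bool (t1 a = i)))"
    if "\<forall>t. 1 + \<kappa> t * s > 0" for a s i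
  proof -
    have "M a s $ i $ i = (\<Sum>t | t a = i. cs s $ t * cnj (cs s $ t))"
      by (auto simp: M_def reduced_density_def intro!: sum.cong)
    also have "\<dots> = (\<Sum>t | t a = i. c $ t * cnj (c $ t) + of_real (s * v t))"
      by (simp only: mod_cs[OF that])
    also have "\<dots> = reduced_density c a $ i $ i + of_real (s * (\<Sum>t | t a = i. v t))"
      by (auto simp: reduced_density_def sum.distrib sum_distrib_left intro!: sum.cong)
    finally show ?thesis
      by (simp add: c diag_def v)
  qed
  have state: "is_state (cs s)" if "\<forall>t. 1 + \<kappa> t * s > 0" for s
  proof -
    have "complex_of_real ((norm (cs s))\<^sup>2) = (\<Sum>t\<in>UNIV. cs s $ t * cnj (cs s $ t))"
      by (simp add: hdot_self[symmetric] hdot_def mult.commute del: of_real_power)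
    also have "\<dots> = (\<Sum>t\<in>UNIV. c $ t * cnj (c $ t) + of_real (s * v t))"
      by (simp only: mod_cs[OF that])
    also have "\<dots> = hdot c c + of_real (s * (\<Sum>t\<in>UNIV. v t))"
      by (simp add: hdot_def sum.distrib sum_distrib_left mult.commute)
    also have "\<dots> = 1"
      using assms(1) by (simp add: hdot_self v0 is_state_def)
    finally show ?thesis
      using power2_eq_iff_nonneg[of "norm (cs s)" 1] by (simp add: is_state_def flip: of_real_power)
  qed
  have lim_diag: "((\<lambda>s. M a s $ i $ i) \<longlongrightarrow> of_real (entry x a i)) (at_right 0)" for a i
  proof -
    have "((\<lambda>s. complex_of_real (entry x a i + s * (of_bool (t0 a = i) - of_bool (t1 a = i))))
        \<longlongrightarrow> of_real (entry x a i + 0 * (of_bool (t0 a = i) - of_bool (t1 a = i)))) (at_right 0)"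
      by (intro tendsto_intros)
    moreover have "\<forall>\<^sub>F s in at_right 0.
        of_real (entry x a i + s * (of_bool (t0 a = i) - of_bool (t1 a = i))) = M a s $ i $ i"
      using small by eventually_elim (rule diag_M[symmetric])
    ultimately show ?thesis
      using Lim_transform_eventually by fastforce
  qed
  \<comment> \<open>The factor gained by the product of the coefficients at \<open>t\<close> and
    \<open>t'\<close>; it is \<open>1 + O(s)\<close>.\<close>
  define g where "g t t' s = sqrt (1 + \<kappa> t * s) * sqrt (1 + \<kappa> t' * s)" for t t' s
  have g: "((\<lambda>s. (g t t' s - 1) / s) \<longlongrightarrow> (\<kappa> t + \<kappa> t') / 2) (at_right 0)" for t t'
  proof -
    have "(g t t' has_real_derivative (\<kappa> t + \<kappa> t') / 2) (at 0)"
      unfolding g_def by (auto intro!: derivative_eq_intros simp: field_simps)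
    then show ?thesis
      by (simp add: has_field_derivative_iff filterlim_at_split g_def)
  qed
  define E where "E a i j = (\<Sum>t | t a = i. c $ t * cnj (c $ t(a := j)) * of_real ((\<kappa> t + \<kappa> (t(a := j))) / 2))"
    for a i j
  have lim_off: "((\<lambda>s. M a s $ i $ j / of_real s) \<longlongrightarrow> E a i j) (at_right 0)" if "i \<noteq> j" for a i j
  proof -
    \<comment> \<open>Since \<open>reduced_density c a\<close> is diagonal, subtracting this zero
      sum replaces \<open>g\<close> by \<open>g - 1\<close> and permits division by
      \<open>s\<close>.\<close>
    have 0: "(\<Sum>t | t a = i. c $ t * cnj (c $ t(a := j))) = 0"
      using arg_cong[OF c[of a], of "\<lambda>A. A $ i $ j"] that by (simp add: reduced_density_def diag_def)
    have "M a s $ i $ j / of_real s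
        = (\<Sum>t | t a = i. c $ t * cnj (c $ t(a := j)) * of_real ((g t (t(a := j)) s - 1) / s))" for s
    proof -
      have "M a s $ i $ j = (\<Sum>t | t a = i. c $ t * cnj (c $ t(a := j)) * of_real (g t (t(a := j)) s))"
        by (simp add: M_def reduced_density_def cs_def g_def mult_ac)
      also have "\<dots> = \<dots> - (\<Sum>t | t a = i. c $ t * cnj (c $ t(a := j)))"
        by (simp add: 0)
      also have "\<dots> = (\<Sum>t | t a = i. c $ t * cnj (c $ t(a := j)) * of_real (g t (t(a := j)) s - 1))"
        by (simp add: sum_subtractf algebra_simps)
      finally show ?thesis by (simp add: sum_divide_distrib)
    qed
    then show ?thesis
      unfolding E_def by (simp only:) (intro tendsto_intros g)
  qed
  have herm: "hermitian (M a s)" for a s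
    by (simp add: M_def hermitian_reduced_density)
  define ev where "ev a s l = ith_smallest_eigenvalue (level_number l) (M a s)"
    for a s and l :: "'m option"
  have ev_lim: "((\<lambda>s. (ev a s l - Re (M a s $ l $ l)) / s) \<longlongrightarrow> 0) (at_right 0)" for a l
    unfolding ev_def by (rule eigenvalues_first_order(1)[OF herm lim_diag lim_off mono])
  have "\<forall>\<^sub>F s in at_right 0. (\<Sum>l\<in>UNIV. ev a s l) = Re (trace (M a s))" for a
    unfolding ev_def by (rule eigenvalues_first_order(2)[OF herm lim_diag lim_off mono])
  then have ev_sum: "\<forall>\<^sub>F s in at_right 0. \<forall>a. (\<Sum>l\<in>UNIV. ev a s l) = Re (trace (M a s))"
    by (simp add: eventually_all_finite)
  define y :: "real \<Rightarrow> ('m, 'n) epoint" where "y s = (\<chi> a i. ev a s (Some i))" for s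
  have "\<forall>\<^sub>F s in at_right 0. has_state (y s)"
    using small ev_sum
  proof eventually_elim
    case (elim s)
    have "(\<Sum>l\<in>UNIV. ev a s l) = 1" for a
      using elim(2)[rule_format, of a] state[OF elim(1)]
      by (simp add: M_def trace_reduced_density is_state_def)
    then have "ev a s None + (\<Sum>i\<in>UNIV. ev a s (Some i)) = 1" for a
      by (simp add: UNIV_option_conv sum.reindex)
    then have "ev a s l = entry (y s) a l" for a l
      by (cases l) (auto simp: entry_def y_def algebra_simps)
    then show ?case
      using state[OF elim(1)] unfolding has_state_def ev_def M_def by blast
  qed
  moreover have "((\<lambda>s. (y s - x) /\<^sub>R s) \<longlongrightarrow> lattice_epoint t0 - lattice_epoint t1) (at_right 0)"
  proof (intro vec_tendstoI)
    fix a i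
    let ?v = "of_bool (t0 a = Some i) - of_bool (t1 a = Some i) :: real"
    have "((\<lambda>s. (ev a s (Some i) - Re (M a s $ Some i $ Some i)) / s + ?v) \<longlongrightarrow> 0 + ?v) (at_right 0)"
      by (intro tendsto_intros ev_lim)
    moreover have "\<forall>\<^sub>F s in at_right 0. (ev a s (Some i) - Re (M a s $ Some i $ Some i)) / s + ?v
        = ((y s - x) /\<^sub>R s) $ a $ i"
      using small eventually_at_right_less
    proof eventually_elim
      case (elim s)
      show ?case
        using elim(2) by (simp add: y_def diag_M[OF elim(1)] entry_def field_simps)
    qed
    ultimately have "((\<lambda>s. ((y s - x) /\<^sub>R s) $ a $ i) \<longlongrightarrow> 0 + ?v) (at_right 0)"
      using Lim_transform_eventually by fastforce
    then show "((\<lambda>s. ((y s - x) /\<^sub>R s) $ a $ i)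
        \<longlongrightarrow> (lattice_epoint t0 - lattice_epoint t1) $ a $ i) (at_right 0)"
      by (simp add: lattice_epoint_def of_bool_def)
  qed
  ultimately show ?thesis using that by blast
qed

section \<open>The gradient condition on the support of a state\<close>

lemma tendsto_of_difference_quotient:
  fixes y :: "real \<Rightarrow> 'a::real_normed_vector"
  assumes "((\<lambda>s. (y s - x) /\<^sub>R s) \<longlongrightarrow> v) (at_right 0)"
  shows "(y \<longlongrightarrow> x) (at_right 0)"
proof -
  have "((\<lambda>s. x + s *\<^sub>R ((y s - x) /\<^sub>R s)) \<longlongrightarrow> x + 0 *\<^sub>R v) (at_right 0)"
    by (intro tendsto_intros assms)
  moreover have "\<forall>\<^sub>F s in at_right 0. x + s *\<^sub>R ((y s - x) /\<^sub>R s) = y s"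
    using eventually_at_right_less by eventually_elim simp
  ultimately show ?thesis
    using Lim_transform_eventually by fastforce
qed

text \<open>If \<open>v \<bullet> w < 0\<close>, the first-order expansion makes
  \<open>f (y s)\<close> negative for small \<open>s > 0\<close>.\<close>

lemma gderiv_nonneg:
  fixes f :: "'a::real_inner \<Rightarrow> real"
  assumes deriv: "GDERIV f x :> w" and "f x = 0"
    and y: "((\<lambda>s. (y s - x) /\<^sub>R s) \<longlongrightarrow> v) (at_right 0)"
    and nonneg: "\<forall>\<^sub>F s in at_right 0. f (y s) \<ge> 0"
  shows "v \<bullet> w \<ge> 0"
proof (rule ccontr)
  assume neg: "\<not> v \<bullet> w \<ge> 0"
  \<comment> \<open>The inner product of the difference quotient with \<open>w\<close> is eventually
    below half of \<open>v \<bullet> w\<close>; this \<open>e\<close> keeps the error within a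
    quarter of its absolute value, as \<open>norm v + 1\<close> eventually bounds the
    quotient.\<close>
  define e where "e = - (v \<bullet> w) / (4 * (norm v + 1))"
  have "norm v + 1 > 0" by (simp add: add_nonneg_pos)
  then have e: "e > 0" "e * (norm v + 1) = - (v \<bullet> w) / 4"
    using neg by (auto simp: e_def field_simps)
  obtain d where d: "d > 0" "\<And>z. norm (z - x) < d \<Longrightarrow>
      norm (f z - f x - (z - x) \<bullet> w) \<le> e * norm (z - x)"
    using deriv e(1) unfolding gderiv_def has_derivative_at_alt by blast
  have "\<forall>\<^sub>F s in at_right 0. dist (y s) x < d"
    using tendsto_of_difference_quotient[OF y] d(1) by (rule tendstoD)
  moreover have "\<forall>\<^sub>F s in at_right 0. norm ((y s - x) /\<^sub>R s) < norm v + 1"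
    using tendsto_norm[OF y] by (rule order_tendstoD) simp
  moreover have "\<forall>\<^sub>F s in at_right 0. ((y s - x) /\<^sub>R s) \<bullet> w < v \<bullet> w / 2"
    using tendsto_inner[OF y tendsto_const] by (rule order_tendstoD) (use neg in simp)
  ultimately have "\<forall>\<^sub>F s in at_right (0::real). False"
    using nonneg eventually_at_right_less
  proof eventually_elim
    case (elim s)
    define r where "r = (y s - x) /\<^sub>R s"
    have yr: "y s - x = s *\<^sub>R r" using elim(5) by (simp add: r_def)
    have "f (y s) \<le> (y s - x) \<bullet> w + e * norm (y s - x)"
      using d(2)[of "y s"] elim(1) \<open>f x = 0\<close> by (simp add: dist_norm abs_le_iff)
    also have "\<dots> = s * (r \<bullet> w + e * norm r)"
      using elim(5) by (simp add: yr algebra_simps)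
    also have "e * norm r \<le> e * (norm v + 1)"
      using elim(2) e(1) by (simp add: r_def)
    then have "s * (r \<bullet> w + e * norm r) < 0"
      using elim(3,5) e(2) neg by (intro mult_pos_neg) (auto simp: r_def)
    finally show ?case using elim(4) by simp
  qed
  then show False by simp
qed

text \<open>The diagonal of each reduced density matrix is a marginal of the weights
  \<open>(cmod (c $ t))\<^sup>2\<close>, and a lattice E-point is the marginal of a unit weight on a
  single tuple.\<close>

lemma diagonal_state_decomposition:
  fixes c :: "('m::finite, 'n::finite) qudits"
  assumes "\<And>a. reduced_density c a = diag (entry x a)"
  shows "x = (\<Sum>t\<in>UNIV. (cmod (c $ t))\<^sup>2 *\<^sub>R lattice_epoint t)"
proof -
  have "x $ a $ i = (\<Sum>t\<in>UNIV. (cmod (c $ t))\<^sup>2 *\<^sub>R lattice_epoint t) $ a $ i" for a i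
  proof -
    have "complex_of_real (x $ a $ i) = reduced_density c a $ Some i $ Some i"
      by (simp add: assms diag_def entry_def)
    also have "\<dots> = of_real (\<Sum>t | t a = Some i. (cmod (c $ t))\<^sup>2)"
      unfolding reduced_density_def of_real_sum
      by (simp add: complex_norm_square del: of_real_power) (auto simp: fun_upd_idem intro!: sum.cong)
    finally have "x $ a $ i = (\<Sum>t | t a = Some i. (cmod (c $ t))\<^sup>2)"
      by (simp only: of_real_eq_iff)
    then show ?thesis
      by (simp add: lattice_epoint_def sum.inter_filter[symmetric] if_distrib cong: if_cong)
  qed
  then show ?thesis by (simp add: vec_eq_iff)
qed

text \<open>Any two tuples of the support can exchange weight in either direction, so
  \<open>w\<close> takes equal values on their lattice E-points. As \<open>x\<close> is a convex
  combination of these, the common value is \<open>w \<bullet> x\<close>.\<close>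

lemma support_gradient:
  fixes x :: "('m::{finite,linorder}, 'n::finite) epoint"
  assumes "open U" "x \<in> U" and inj: "\<And>a. inj (entry x a)"
    and deriv: "GDERIV f x :> w" and "f x = 0"
    and has_state_iff: "\<And>y. y \<in> U \<Longrightarrow> has_state y \<longleftrightarrow> f y \<ge> 0"
  shows "x \<in> V {t. w \<bullet> lattice_epoint t = w \<bullet> x}"
proof -
  have x: "has_state x" using assms(2,5) has_state_iff by simp
  obtain c :: "('m, 'n) qudits" where c: "is_state c" "\<And>a. reduced_density c a = diag (entry x a)"
    using has_state_diagonal[OF x inj] by blast
  have le: "lattice_epoint t1 \<bullet> w \<le> lattice_epoint t0 \<bullet> w" if nz: "c $ t0 \<noteq> 0" "c $ t1 \<noteq> 0" for t0 t1
  proof (cases "t0 = t1")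
    case False
    obtain y where y: "\<forall>\<^sub>F s in at_right 0. has_state (y s)"
      "((\<lambda>s. (y s - x) /\<^sub>R s) \<longlongrightarrow> lattice_epoint t0 - lattice_epoint t1) (at_right 0)"
      using has_state_variation[OF c entry_strict_mono[OF x inj] nz False] by blast
    have "\<forall>\<^sub>F s in at_right 0. y s \<in> U"
      using tendsto_of_difference_quotient[OF y(2)] assms(1,2) by (rule topological_tendstoD)
    then have "\<forall>\<^sub>F s in at_right 0. f (y s) \<ge> 0"
      using y(1) by eventually_elim (simp add: has_state_iff)
    then have "(lattice_epoint t0 - lattice_epoint t1) \<bullet> w \<ge> 0"
      by (rule gderiv_nonneg[OF deriv \<open>f x = 0\<close> y(2)])
    then show ?thesis by (simp add: inner_diff_left)
  qed simp
  define A where "A t = (cmod (c $ t))\<^sup>2" for t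
  have xA: "x = (\<Sum>t\<in>UNIV. A t *\<^sub>R lattice_epoint t)"
    unfolding A_def by (rule diagonal_state_decomposition[OF c(2)])
  have A1: "(\<Sum>t\<in>UNIV. A t) = 1"
    using c(1) by (simp add: A_def is_state_def norm_vec_def L2_set_def)
  have supp: "w \<bullet> lattice_epoint t = w \<bullet> x" if "A t \<noteq> 0" for t
  proof -
    have t: "c $ t \<noteq> 0" using that by (simp add: A_def)
    \<comment> \<open>Either \<open>u\<close> is off the support and both sides vanish, or
      \<open>le\<close> applies in both directions.\<close>
    have eq: "A u * (w \<bullet> lattice_epoint u) = A u * (w \<bullet> lattice_epoint t)" for u
      using le[OF t, of u] le[OF _ t, of u]
      by (cases "c $ u = 0") (auto simp: A_def inner_commute[of w])
    have "w \<bullet> x = (\<Sum>u\<in>UNIV. A u * (w \<bullet> lattice_epoint u))"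
      by (subst xA) (simp add: inner_sum_right)
    also have "\<dots> = (\<Sum>u\<in>UNIV. A u * (w \<bullet> lattice_epoint t))"
      by (rule sum.cong[OF refl eq])
    finally show ?thesis by (simp add: A1 flip: sum_distrib_right)
  qed
  let ?N = "{t. w \<bullet> lattice_epoint t = w \<bullet> x}"
  have "A t \<le> 1" for t
    unfolding A1[symmetric] by (rule member_le_sum) (auto simp: A_def)
  moreover have "(\<Sum>t\<in>?N. A t) = 1"
    unfolding A1[symmetric] by (rule sum.mono_neutral_left) (use supp in auto)
  moreover have "x = (\<Sum>t\<in>?N. A t *\<^sub>R lattice_epoint t)"
    by (subst xA, rule sum.mono_neutral_right) (use supp in auto)
  ultimately show ?thesis
    unfolding V_def by (auto simp: A_def intro!: exI[of _ A])
qed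

section \<open>Lattice polytopes\<close>

lemma inj_lattice_epoint: "inj (lattice_epoint :: ('m::finite, 'n::finite) multi_index \<Rightarrow> _)"
proof (rule injI, rule ext)
  fix t u :: "('m, 'n) multi_index" and a
  assume "lattice_epoint t = lattice_epoint u"
  then have "entry (lattice_epoint u) a (t a) = 1"
    using entry_lattice_epoint[of t a "t a"] by simp
  then show "t a = u a"
    by (simp add: entry_lattice_epoint split: if_splits)
qed

text \<open>Injectivity of \<open>lattice_epoint\<close> turns weights on points into weights on
  tuples; nonnegative weights with sum 1 are at most 1.\<close>

lemma V_eq_convex_hull: "V N = convex hull (lattice_epoint ` N)"
proof (intro equalityI subsetI)
  fix x assume "x \<in> V N"
  then obtain A where A: "x = (\<Sum>t\<in>N. A t *\<^sub>R lattice_epoint t)" "\<forall>t\<in>N. 0 \<le> A t" "(\<Sum>t\<in>N. A t) = 1"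
    by (auto simp: V_def)
  show "x \<in> convex hull (lattice_epoint ` N)"
    unfolding A(1) using A(2,3) by (intro convex_sum) (auto intro: hull_inc)
next
  fix x assume "x \<in> convex hull (lattice_epoint ` N)"
  then obtain u where u: "\<forall>y\<in>lattice_epoint ` N. 0 \<le> u y" "sum u (lattice_epoint ` N) = 1"
    "(\<Sum>y\<in>lattice_epoint ` N. u y *\<^sub>R y) = x"
    by (auto simp: convex_hull_finite)
  have inj: "inj_on lattice_epoint N"
    using inj_lattice_epoint inj_on_subset by blast
  define A where "A = u \<circ> lattice_epoint"
  have A: "(\<Sum>t\<in>N. A t) = 1" "x = (\<Sum>t\<in>N. A t *\<^sub>R lattice_epoint t)" "\<forall>t\<in>N. 0 \<le> A t"
    using u by (simp_all add: sum.reindex[OF inj] A_def)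
  then have "\<forall>t\<in>N. A t \<le> 1"
    using member_le_sum[of _ N A] by auto
  with A show "x \<in> V N" unfolding V_def by blast
qed

text \<open>The tuple with \<open>None\<close> everywhere gives the origin, and a single
  \<open>Some\<close> gives a standard basis vector.\<close>

lemma aff_dim_range_lattice_epoint:
  "aff_dim (range (lattice_epoint :: ('m::finite, 'n::finite) multi_index \<Rightarrow> _)) = DIM(('m, 'n) epoint)"
proof -
  let ?L = "range (lattice_epoint :: ('m, 'n) multi_index \<Rightarrow> _)"
  have "lattice_epoint (\<lambda>_. None) = (0 :: ('m, 'n) epoint)"
    by (simp add: lattice_epoint_def vec_eq_iff)
  then have "0 \<in> ?L" by (metis rangeI)
  then have "aff_dim ?L = int (dim ?L)"
    by (intro aff_dim_zero hull_inc)
  moreover have "(Basis :: ('m, 'n) epoint set) \<subseteq> ?L"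
  proof
    fix b :: "('m, 'n) epoint" assume "b \<in> Basis"
    then obtain a i where "b = axis a (axis i 1)"
      by (auto simp: Basis_vec_def)
    then have "b = lattice_epoint ((\<lambda>_. None)(a := Some i))"
      by (auto simp: lattice_epoint_def vec_eq_iff axis_def)
    then show "b \<in> ?L" by blast
  qed
  then have "dim (Basis :: ('m, 'n) epoint set) \<le> dim ?L"
    by (rule dim_subset)
  then have "dim ?L = DIM(('m, 'n) epoint)"
    using dim_subset_UNIV[of ?L] by (metis dim_UNIV dim_span le_antisym span_Basis)
  ultimately show ?thesis by simp
qed

text \<open>Drop one vertex of an affine basis chosen among the lattice E-points. This serves the
  case of an empty hypersurface.\<close>

lemma exists_hyperplane_V:
  obtains N :: "('m::finite, 'n::finite) multi_index set"
  where "aff_dim (V N) = int (DIM(('m, 'n) epoint)) - 1"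
proof -
  obtain B :: "('m, 'n) epoint set" where B: "B \<subseteq> range lattice_epoint" "\<not> affine_dependent B"
    "int (card B) = int (DIM(('m, 'n) epoint)) + 1"
    using aff_dim_inner_basis_exists[of "range lattice_epoint :: ('m, 'n) epoint set"]
    by (metis aff_dim_range_lattice_epoint)
  then have "card B \<noteq> 0" by linarith
  then have "B \<noteq> {}" by auto
  then obtain b where b: "b \<in> B" by blast
  have "finite B" by (rule finite_subset[OF B(1)]) simp
  have "\<not> affine_dependent (B - {b})"
    using B(2) affine_independent_Diff by blast
  then have "aff_dim (B - {b}) = int (card (B - {b})) - 1"
    by (simp add: aff_dim_affine_independent)
  then have "aff_dim (B - {b}) = int (DIM(('m, 'n) epoint)) - 1"
    using B(3) b \<open>finite B\<close> by (simp add: card_Diff_singleton of_nat_diff)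
  moreover have "lattice_epoint ` (lattice_epoint -` (B - {b})) = B - {b}"
    using B(1) by auto
  ultimately show ?thesis
    using that[of "lattice_epoint -` (B - {b})"] by (simp add: V_eq_convex_hull aff_dim_convex_hull)
qed

section \<open>The hypersurface\<close>

text \<open>The component \<open>z\<close> of \<open>c\<close> orthogonal to \<open>a\<close> is a
  direction inside the first hyperplane, so \<open>c \<bullet> z = 0\<close> and \<open>z\<close>
  vanishes.\<close>

lemma hyperplane_subset_parallel:
  fixes a c :: "'a::euclidean_space"
  assumes "a \<noteq> 0" and sub: "{y. a \<bullet> y = b} \<subseteq> {y. c \<bullet> y = d}"
  shows "c = (c \<bullet> a / (a \<bullet> a)) *\<^sub>R a"
proof -
  define k where "k = c \<bullet> a / (a \<bullet> a)"
  define z where "z = c - k *\<^sub>R a"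
  define y where "y = (b / (a \<bullet> a)) *\<^sub>R a"
  have az: "a \<bullet> z = 0" and ay: "a \<bullet> y = b"
    using \<open>a \<noteq> 0\<close> by (simp_all add: z_def k_def y_def inner_diff_right inner_commute)
  then have "y \<in> {y. a \<bullet> y = b}" "y + z \<in> {y. a \<bullet> y = b}"
    by (simp_all add: inner_add_right)
  then have "c \<bullet> y = d" "c \<bullet> (y + z) = d"
    using sub by blast+
  then have "c \<bullet> z = 0" by (simp add: inner_add_right)
  then have "z \<bullet> z = 0"
    using az by (simp add: z_def inner_diff_left)
  then show ?thesis by (simp add: z_def k_def)
qed

text \<open>Two unit normals of one hyperplane are parallel, hence equal up to sign.\<close>

lemma finite_unit_normals:
  fixes H :: "'a::euclidean_space set"
  shows "finite {g. norm g = 1 \<and> (\<exists>b. H = {y. g \<bullet> y = b})}"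
proof (cases "\<exists>g b. norm g = 1 \<and> H = {y. g \<bullet> y = b}")
  case True
  then obtain g b where g: "norm g = 1" "H = {y. g \<bullet> y = b}" by blast
  have "h \<in> {g, - g}" if h: "norm h = 1" "H = {y. h \<bullet> y = b'}" for h b'
  proof -
    define k where "k = h \<bullet> g / (g \<bullet> g)"
    have "h = k *\<^sub>R g"
      unfolding k_def using g h by (intro hyperplane_subset_parallel[of g b h b']) auto
    moreover from this have "\<bar>k\<bar> = 1" using g(1) h(1) by simp
    ultimately show ?thesis by (auto simp: abs_if split: if_splits)
  qed
  then have "{g. norm g = 1 \<and> (\<exists>b. H = {y. g \<bullet> y = b})} \<subseteq> {g, - g}"
    by blast
  then show ?thesis
    by (rule finite_subset) simp
next
  case False
  then have "{g. norm g = 1 \<and> (\<exists>b. H = {y. g \<bullet> y = b})} = {}" by blast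
  then show ?thesis by (simp only: finite.emptyI)
qed

text \<open>Every line parallel to the gradient at \<open>x0\<close> that passes close to \<open>x0\<close> meets the
  hypersurface, while the lines in this direction through a set of codimension at least two
  only fill a hyperplane.\<close>

lemma hypersurface_avoids_lowdim:
  fixes f :: "'a::euclidean_space \<Rightarrow> real"
  assumes "open W" "x0 \<in> W"
    and deriv: "\<And>x. x \<in> W \<Longrightarrow> GDERIV f x :> grad x"
    and "grad x0 \<noteq> 0" "f x0 = 0"
    and "finite \<A>" and low: "\<And>A. A \<in> \<A> \<Longrightarrow> aff_dim A < int (DIM('a)) - 1"
  obtains x where "x \<in> W" "f x = 0" "x \<notin> \<Union>\<A>"
proof -
  define g where "g = grad x0"
  have "g \<noteq> 0" using assms(4) by (simp add: g_def)
  \<comment> \<open>Adding \<open>a + g\<close> to a nonempty \<open>A\<close> raises the dimension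
    by at most one, so some hyperplane contains both; its normal is orthogonal to \<open>g\<close>.
    For empty \<open>A\<close> any nonzero \<open>p\<close> will do.\<close>
  have "\<exists>p q. p \<noteq> 0 \<and> (A \<noteq> {} \<longrightarrow> p \<bullet> g = 0) \<and> A \<subseteq> {x. p \<bullet> x = q}" if "A \<in> \<A>" for A
  proof (cases "A = {}")
    case False
    then obtain a where a: "a \<in> A" by blast
    have "aff_dim (insert (a + g) A) < int (DIM('a))"
      using low[OF that] by (simp add: aff_dim_insert)
    then obtain p q where "p \<noteq> 0" "insert (a + g) A \<subseteq> {x. p \<bullet> x = q}"
      using aff_lowdim_subset_hyperplane by blast
    then show ?thesis using a by (intro exI[of _ p] exI[of _ q]) (auto simp: inner_add_right)
  next
    case True
    then show ?thesis using \<open>g \<noteq> 0\<close> by blast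
  qed
  then obtain p q where pq: "\<And>A. A \<in> \<A> \<Longrightarrow> p A \<noteq> 0" "\<And>A. A \<in> \<A> \<Longrightarrow> A \<noteq> {} \<Longrightarrow> p A \<bullet> g = 0"
    "\<And>A. A \<in> \<A> \<Longrightarrow> A \<subseteq> {x. p A \<bullet> x = q A}"
    by metis
  \<comment> \<open>A line in direction \<open>g\<close> that starts outside \<open>Z\<close> never
    meets a member of \<open>\<A>\<close>, because \<open>p A \<bullet> g = 0\<close> for nonempty
    \<open>A\<close>. Being negligible, \<open>Z\<close> can be avoided.\<close>
  define Z where "Z = (\<Union>A\<in>\<A>. {x. p A \<bullet> x = q A})"
  have "negligible Z"
    unfolding Z_def using \<open>finite \<A>\<close> pq(1) by (intro negligible_Union) (auto intro: negligible_hyperplane)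
  obtain r where r: "r > 0" "ball x0 r \<subseteq> W"
    using assms(1,2) open_contains_ball by blast
  have cont: "continuous_on W f"
    using deriv unfolding gderiv_def
    by (metis continuous_at_imp_continuous_on has_derivative_continuous)
  have "((\<lambda>s. f (x0 + s *\<^sub>R g)) has_derivative (\<lambda>s. (s *\<^sub>R g) \<bullet> g)) (at 0)"
    using deriv[OF \<open>x0 \<in> W\<close>] unfolding gderiv_def g_def
    by (intro has_derivative_compose[of "\<lambda>s. x0 + s *\<^sub>R grad x0" _ 0 UNIV f])
       (auto intro!: derivative_eq_intros)
  then have der: "DERIV (\<lambda>s. f (x0 + s *\<^sub>R g)) 0 :> g \<bullet> g"
    by (simp add: has_field_derivative_def mult_commute_abs)
  have "g \<bullet> g > 0" using \<open>g \<noteq> 0\<close> by simp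
  obtain d1 where d1: "d1 > 0" "\<And>h. h > 0 \<Longrightarrow> h < d1 \<Longrightarrow> f (x0 + h *\<^sub>R g) > 0"
    using DERIV_pos_inc_right[OF der \<open>g \<bullet> g > 0\<close>] \<open>f x0 = 0\<close> by auto
  obtain d2 where d2: "d2 > 0" "\<And>h. h > 0 \<Longrightarrow> h < d2 \<Longrightarrow> f (x0 - h *\<^sub>R g) < 0"
    using DERIV_pos_inc_left[OF der \<open>g \<bullet> g > 0\<close>] \<open>f x0 = 0\<close> by auto
  \<comment> \<open>Halving keeps \<open>e\<close> strictly below \<open>d1\<close> and
    \<open>d2\<close> and leaves \<open>r / 2\<close> for moving the base point from
    \<open>x0\<close> to \<open>y\<close>.\<close>
  define e where "e = min (min (d1 / 2) (d2 / 2)) (r / (2 * norm g))"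
  have e: "e > 0" "e < d1" "e < d2" "e * norm g \<le> r / 2"
  proof -
    have "e \<le> d1 / 2" "e \<le> d2 / 2" "e \<le> r / (2 * norm g)" by (simp_all add: e_def)
    then show "e < d1" "e < d2" "e * norm g \<le> r / 2"
      using d1(1) d2(1) \<open>g \<noteq> 0\<close> by (simp_all add: field_simps)
    show "e > 0" using d1(1) d2(1) r(1) \<open>g \<noteq> 0\<close> by (simp add: e_def)
  qed
  have in_W: "y + s *\<^sub>R g \<in> W" if "dist y x0 < r / 2" "\<bar>s\<bar> \<le> e" for y s
  proof -
    have "norm (s *\<^sub>R g) \<le> r / 2"
      using mult_right_mono[OF that(2) norm_ge_zero[of g]] e(4) by simp
    then have "dist (y + s *\<^sub>R g) x0 < r"
      using that(1) norm_triangle_ineq[of "y - x0" "s *\<^sub>R g"] by (simp add: dist_norm algebra_simps)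
    then show ?thesis using r(2) by (auto simp: dist_commute)
  qed
  have lim: "((\<lambda>y. f (y + s *\<^sub>R g)) \<longlongrightarrow> f (x0 + s *\<^sub>R g)) (at x0)" if "\<bar>s\<bar> \<le> e" for s
  proof -
    have "isCont f (x0 + s *\<^sub>R g)"
      using cont in_W[of x0 s] that r(1) by (simp add: continuous_on_eq_continuous_at[OF \<open>open W\<close>])
    then show ?thesis
      by (rule isCont_tendsto_compose) (intro tendsto_intros)
  qed
  have "\<forall>\<^sub>F y in at x0. f (y + e *\<^sub>R g) > 0"
    using lim by (rule order_tendstoD) (use d1(2) e in auto)
  moreover have "\<forall>\<^sub>F y in at x0. f (y + (- e) *\<^sub>R g) < 0"
    using lim by (rule order_tendstoD) (use d2(2) e in auto)
  moreover have "\<forall>\<^sub>F y in at x0. dist y x0 < r / 2"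
    using r(1) by (auto simp: eventually_at intro!: exI[of _ "r / 2"])
  ultimately have "\<forall>\<^sub>F y in at x0. f (y + e *\<^sub>R g) > 0 \<and> f (y + (- e) *\<^sub>R g) < 0 \<and> dist y x0 < r / 2"
    by (intro eventually_conj)
  then obtain \<delta> where \<delta>: "\<delta> > 0" "\<And>y. y \<noteq> x0 \<Longrightarrow> dist y x0 < \<delta> \<Longrightarrow>
      f (y + e *\<^sub>R g) > 0 \<and> f (y + (- e) *\<^sub>R g) < 0 \<and> dist y x0 < r / 2"
    by (auto simp: eventually_at)
  \<comment> \<open>\<open>x0\<close> joins the null set because the sign estimates are stated on a
    punctured neighbourhood.\<close>
  have "negligible (insert x0 Z)" using \<open>negligible Z\<close> by (simp add: negligible_insert)
  then have "\<not> ball x0 \<delta> \<subseteq> insert x0 Z"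
    using open_not_negligible[of "ball x0 \<delta>"] negligible_subset[of "insert x0 Z"] \<delta>(1) by auto
  then obtain y where "y \<in> ball x0 \<delta>" and y: "y \<noteq> x0" "y \<notin> Z"
    by blast
  then have y_near: "dist y x0 < \<delta>" by (simp add: dist_commute)
  have y_W: "y + s *\<^sub>R g \<in> W" if "s \<in> {- e..e}" for s
    using that in_W \<delta>(2)[OF y(1) y_near] by auto
  have "continuous_on {- e..e} (\<lambda>s. f (y + s *\<^sub>R g))"
    by (rule continuous_on_compose2[OF cont]) (use y_W in \<open>auto intro!: continuous_intros\<close>)
  then obtain s where s: "s \<in> {- e..e}" "f (y + s *\<^sub>R g) = 0"
    using IVT'[of "\<lambda>s. f (y + s *\<^sub>R g)" "- e" 0 e] \<delta>(2)[OF y(1) y_near] e(1) by fastforce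
  moreover have "y + s *\<^sub>R g \<notin> A" if "A \<in> \<A>" for A
  proof
    assume "y + s *\<^sub>R g \<in> A"
    then have "p A \<bullet> (y + s *\<^sub>R g) = q A" "p A \<bullet> g = 0"
      using pq(2,3)[OF that] by blast+
    then have "p A \<bullet> y = q A"
      by (simp add: inner_add_right)
    then show False using y(2) that by (auto simp: Z_def)
  qed
  ultimately show ?thesis
    using that[of "y + s *\<^sub>R g"] y_W by blast
qed

section \<open>Constancy of the unit normal and the offset along the hypersurface\<close>

theorem proposition14:
  fixes U :: "('m::{finite,linorder}, 'n::finite) epoint set"
    and f :: "('m, 'n) epoint \<Rightarrow> real"
    and grad :: "('m, 'n) epoint \<Rightarrow> ('m, 'n) epoint"
  assumes "open U"
    and nondegenerate: "\<And>x a. x \<in> U \<Longrightarrow> inj (entry x a)"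
    and gradient: "\<And>x. x \<in> U \<Longrightarrow> GDERIV f x :> grad x"
    and "continuous_on U grad"
    and "\<And>x. x \<in> U \<Longrightarrow> grad x \<noteq> 0"
    and has_state_iff: "\<And>x. x \<in> U \<Longrightarrow> has_state x \<longleftrightarrow> f x \<ge> 0"
    and "connected {x \<in> U. f x = 0}"
  shows "\<exists>N :: ('m, 'n) multi_index set.
           (\<exists>w b. w \<noteq> 0 \<and> V N \<subseteq> {x. w \<bullet> x = b}) \<and>
           aff_dim (V N) = int (CARD('n) * (CARD('m option) - 1)) - 1 \<and>
           {x \<in> U. f x = 0} \<subseteq> V N"
proof -
  define S where "S = {x \<in> U. f x = 0}"
  define \<nu> where "\<nu> x = grad x /\<^sub>R norm (grad x)" for x
  \<comment> \<open>For \<open>x\<close> in \<open>S\<close>, the tuples on the affine tangent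
    hyperplane of the hypersurface at \<open>x\<close>.\<close>
  define face where "face x = {t. grad x \<bullet> lattice_epoint t = grad x \<bullet> x}" for x
  define D where "D = int (DIM(('m, 'n) epoint))"
  have D: "int (CARD('n) * (CARD('m option) - 1)) = D" by (simp add: D_def)
  have \<nu>: "norm (\<nu> x) = 1" "\<nu> x \<bullet> y = \<nu> x \<bullet> z \<longleftrightarrow> grad x \<bullet> y = grad x \<bullet> z" if "x \<in> U" for x y z
    using assms(5)[OF that] by (simp_all add: \<nu>_def)
  have in_face: "x \<in> V (face x)" if "x \<in> S" for x
    unfolding face_def using that
    by (intro support_gradient[OF \<open>open U\<close> _ nondegenerate gradient _ has_state_iff]) (auto simp: S_def)
  \<comment> \<open>Points whose face spans the whole tangent hyperplane are dense in
    \<open>S\<close>: the lower-dimensional \<open>V N\<close> are finitely many and cannot cover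
    \<open>S\<close> near \<open>x0\<close>.\<close>
  have dense: "\<exists>x\<in>S \<inter> W. aff_dim (V (face x)) = D - 1" if W: "open W" "x0 \<in> W" "x0 \<in> S" for W x0
  proof -
    let ?\<A> = "{V N | N :: ('m, 'n) multi_index set. aff_dim (V N) < D - 1}"
    have "finite ?\<A>" by simp
    then obtain x where x: "x \<in> W \<inter> U" "f x = 0" "x \<notin> \<Union>?\<A>"
      using W \<open>open U\<close> gradient assms(5)
      by (rule_tac hypersurface_avoids_lowdim[of "W \<inter> U" x0 f grad ?\<A>]) (auto simp: S_def D_def)
    then have "x \<in> S" by (simp add: S_def)
    have ge: "aff_dim (V (face x)) \<ge> D - 1"
      using x(3) in_face[OF \<open>x \<in> S\<close>] by (metis (mono_tags, lifting) UnionI mem_Collect_eq not_le)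
    have "V (face x) \<subseteq> {y. grad x \<bullet> y = grad x \<bullet> x}"
      unfolding V_eq_convex_hull
      by (intro hull_minimal convex_hyperplane) (auto simp: face_def)
    then have "aff_dim (V (face x)) \<le> aff_dim {y. grad x \<bullet> y = grad x \<bullet> x}"
      by (rule aff_dim_subset)
    also have "\<dots> = D - 1"
      using assms(5)[of x] x(1) by (simp add: D_def)
    finally have "aff_dim (V (face x)) \<le> D - 1" .
    with ge show ?thesis using x(1) \<open>x \<in> S\<close> by (intro bexI[of _ x]) auto
  qed
  \<comment> \<open>All unit normals to hyperplanes spanned by some \<open>V N\<close>, at most two
    for each \<open>N\<close>.\<close>
  define G where "G = (\<Union>N :: ('m, 'n) multi_index set.
    {g. norm g = 1 \<and> (\<exists>b. affine hull V N = {y. g \<bullet> y = b})})"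
  have "finite G"
    unfolding G_def by (intro finite_UN_I finite_unit_normals) simp
  have dense_G: "\<nu> x \<in> G" if "x \<in> S" "aff_dim (V (face x)) = D - 1" for x
  proof -
    have "x \<in> U" using that(1) by (simp add: S_def)
    let ?H = "{y. \<nu> x \<bullet> y = \<nu> x \<bullet> x}"
    have "V (face x) \<subseteq> ?H"
      unfolding V_eq_convex_hull \<nu>(2)[OF \<open>x \<in> U\<close>]
      by (intro hull_minimal convex_hyperplane) (auto simp: face_def)
    then have "affine hull V (face x) \<subseteq> ?H"
      by (intro hull_minimal affine_hyperplane)
    then have "affine hull V (face x) = ?H"
    proof (rule affine_dim_equal[rotated 3])
      have "\<nu> x \<noteq> 0" using \<nu>(1)[OF \<open>x \<in> U\<close>] by auto
      then show "aff_dim (affine hull V (face x)) = aff_dim ?H"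
        using that(2) by (simp add: D_def)
      show "affine hull V (face x) \<noteq> {}" using in_face[OF that(1)] by auto
    qed (simp_all add: affine_hyperplane)
    then show ?thesis using \<nu>(1)[OF \<open>x \<in> U\<close>] by (auto simp: G_def)
  qed
  have cont: "continuous_on U \<nu>"
    unfolding \<nu>_def using assms(4,5) by (intro continuous_intros) auto
  \<comment> \<open>Were \<open>\<nu> x\<close> outside the closed set \<open>G\<close>, so would be
    the normals at all nearby points of \<open>S\<close>, against density.\<close>
  have "\<nu> x \<in> G" if "x \<in> S" for x
  proof (rule ccontr)
    assume "\<nu> x \<notin> G"
    have "open (U \<inter> \<nu> -` (- G))"
      using cont \<open>open U\<close> \<open>finite G\<close> by (intro continuous_open_preimage) (auto intro: finite_imp_closed)
    then show False
      using dense[of "U \<inter> \<nu> -` (- G)" x] dense_G \<open>\<nu> x \<notin> G\<close> that by (auto simp: S_def)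
  qed
  then have "\<nu> ` S \<subseteq> G" by blast
  then have finite_\<nu>: "finite (\<nu> ` S)"
    using \<open>finite G\<close> by (rule finite_subset)
  show ?thesis
  proof (cases "S = {}")
    \<comment> \<open>An empty hypersurface still requires some \<open>N\<close> with
      \<open>V N\<close> of codimension one.\<close>
    case True
    obtain N :: "('m, 'n) multi_index set" where N: "aff_dim (V N) = D - 1"
      using exists_hyperplane_V unfolding D_def by blast
    then obtain w b where "w \<noteq> 0" "affine hull V N = {x. w \<bullet> x = b}"
      using aff_dim_eq_hyperplane[of "V N"] by (auto simp: D_def)
    then show ?thesis
      using N True hull_subset[of "V N" affine] unfolding S_def D by (intro exI[of _ N]) auto
  next
    case False
    \<comment> \<open>A nonempty connected finite set is a single point; this is applied to the unit
      normals and then to the offsets \<open>u \<bullet> x\<close>.\<close>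
    have "connected (\<nu> ` S)"
      using assms(7) cont unfolding S_def
      by (intro connected_continuous_image) (auto intro: continuous_on_subset)
    then obtain u where u: "\<nu> ` S = {u}"
      using finite_\<nu> False connected_finite_iff_sing by blast
    \<comment> \<open>The offset at \<open>x\<close> is attained at a lattice E-point of its face,
      so only finitely many values occur.\<close>
    have "u \<bullet> x \<in> range (\<lambda>t. u \<bullet> lattice_epoint t)" if xS: "x \<in> S" for x
    proof -
      have "face x \<noteq> {}"
        using in_face[OF xS] by (auto simp: V_eq_convex_hull)
      then obtain t where "t \<in> face x" by blast
      then have "\<nu> x \<bullet> lattice_epoint t = \<nu> x \<bullet> x"
        using xS \<nu>(2)[of x] by (auto simp: face_def S_def)
      then show ?thesis using u xS by (metis image_eqI rangeI singletonD)
    qed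
    then have "(\<bullet>) u ` S \<subseteq> range (\<lambda>t. u \<bullet> lattice_epoint t)" by blast
    then have "finite ((\<bullet>) u ` S)"
      by (rule finite_subset) simp
    moreover have "connected ((\<bullet>) u ` S)"
      using assms(7) unfolding S_def by (intro connected_continuous_image continuous_intros)
    ultimately obtain b where b: "(\<bullet>) u ` S = {b}"
      using False connected_finite_iff_sing by blast
    define N where "N = {t :: ('m, 'n) multi_index. u \<bullet> lattice_epoint t = b}"
    have face: "face x = N" if "x \<in> S" for x
    proof -
      have "\<nu> x = u" "u \<bullet> x = b" using u b that by auto
      then show ?thesis
        using that \<nu>(2)[of x _ x] by (auto simp: face_def N_def S_def)
    qed
    obtain x0 where "x0 \<in> S" using False by blast
    \<comment> \<open>All faces equal \<open>N\<close>, so a single point with a full-dimensional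
      face suffices.\<close>
    have "aff_dim (V N) = D - 1"
      using dense[of UNIV x0] face \<open>x0 \<in> S\<close> by auto
    moreover have "S \<subseteq> V N" using in_face face by auto
    moreover have "V N \<subseteq> {x. u \<bullet> x = b}"
      unfolding V_eq_convex_hull by (intro hull_minimal convex_hyperplane) (auto simp: N_def)
    moreover have "norm u = 1"
      using u \<nu>(1)[of x0] \<open>x0 \<in> S\<close> by (auto simp: S_def)
    then have "u \<noteq> 0" by auto
    ultimately show ?thesis unfolding S_def D by blast
  qed
qed

end
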